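(* There exist universal constants $C,c>0$ such that the following two statements hold for all $n\in\mathbb{N}$, all even $k\in\mathbb{N}$ and all $0<p<1$, where $N=np(1-p)-1$. 1. For every $m>0$ there exists $N_0=N_0(m)$ (depending only on $m$) such that if $N>N_0$ and $k\le(\log N)^m$, then $$\frac{c}{\sqrt k}\left(\frac{pk}{2e(1-p)n}\right)^{k/2}\le M(n,k,p)\le C\sqrt k\left(\frac{pk}{2e(1-p)n}\right)^{k/2}.$$ 2. For every $0<\beta<1$ there exist $c(\beta)>0$ and $N_0=N_0(\beta)$ (depending only on $\beta$) such that if $N>N_0$ and $k\le N^\beta$, then $$\frac1C\,e^{-\frac{k}{U(k,\beta)}}\left(\frac{pk}{2e(1-p)n}\right)^{k/2}\le M(n,k,p)\le C\sqrt k\,e^{\frac{k^2}{2n}}\left(\frac{pk}{2e(1-p)n}\right)^{k/2},$$ where $U(k,\beta)=\exp\left(c(\beta)\sqrt{\log(k)\,\log\log(2k)}\right)$.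
   Context: $\mathbb{N}$ denotes the positive integers, $\log$ the natural logarithm, and $e$ its base. For $n,k\in\mathbb{N}$ and $0<p<1$, $\mathcal{A}(n,k,p)$ is the set of all probability distributions of $(X_1,\dots,X_n)$ on $\{0,1\}^n$ that are $k$-wise independent with identical marginals $p$, i.e. $\mathbb{P}(X_i=1\ \forall i\in S)=p^{|S|}$ for all $S\subseteq\{1,\dots,n\}$ with $|S|\le k$. Define $$M(n,k,p)=\max_{\mathbb{Q}\in\mathcal{A}(n,k,p)}\mathbb{Q}(X_1=\dots=X_n=1).$$ *)

theory Defs
  imports "HOL-Probability.Probability"
begin

definition bit_vectors :: "nat \<Rightarrow> (nat \<Rightarrow> nat) set" where
  "bit_vectors n = {1..n} \<rightarrow>\<^sub>E {0, 1}"

definition kwise_indep_dists :: "nat \<Rightarrow> nat \<Rightarrow> real \<Rightarrow> (nat \<Rightarrow> nat) pmf set" where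
  "kwise_indep_dists n k p =
     {Q. set_pmf Q \<subseteq> bit_vectors n \<and>
         (\<forall>S. S \<subseteq> {1..n} \<and> card S \<le> k \<longrightarrow>
            measure_pmf.prob Q {x. \<forall>i\<in>S. x i = 1} = p ^ card S)}"

(* Greatest is used because the maximum ranges over an infinite set;
   that it is attained is shown in max_all_ones_attained below. *)
definition max_all_ones :: "nat \<Rightarrow> nat \<Rightarrow> real \<Rightarrow> real" where
  "max_all_ones n k p =
     (GREATEST r. \<exists>Q\<in>kwise_indep_dists n k p.
        r = measure_pmf.prob Q {x. \<forall>i\<in>{1..n}. x i = 1})"

lemma finite_bit_vectors: "finite (bit_vectors n)"
  by (simp add: bit_vectors_def finite_PiE)

lemma kwise_indep_dists_nonempty:
  assumes "0 < p" "p < 1"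
  shows "kwise_indep_dists n k p \<noteq> {}"
proof -
  define Q where "Q = Pi_pmf {1..n} undefined (\<lambda>_. map_pmf of_bool (bernoulli_pmf p) :: nat pmf)"
  have "set_pmf Q \<subseteq> bit_vectors n"
  proof
    fix x assume "x \<in> set_pmf Q"
    then have x: "x \<in> PiE_dflt {1..n} undefined (set_pmf \<circ> (\<lambda>_. map_pmf of_bool (bernoulli_pmf p)))"
      unfolding Q_def by (rule subsetD[OF set_Pi_pmf_subset'[OF finite_atLeastAtMost]])
    show "x \<in> bit_vectors n"
      unfolding bit_vectors_def
    proof (rule PiE_I)
      fix i assume "i \<in> {1..n}"
      then have "x i \<in> set_pmf (map_pmf of_bool (bernoulli_pmf p))"
        using x by (simp add: PiE_dflt_def)
      then obtain b :: bool where "x i = of_bool b" by auto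
      then show "x i \<in> {0, 1}" by (cases b) auto
    next
      fix i assume "i \<notin> {1..n}"
      then show "x i = undefined"
        using x by (simp add: PiE_dflt_def)
    qed
  qed
  moreover have "measure_pmf.prob Q {x. \<forall>i\<in>S. x i = 1} = p ^ card S"
    if S: "S \<subseteq> {1..n}" for S
  proof -
    have "{x. \<forall>i\<in>S. x i = (1::nat)} = Pi {1..n} (\<lambda>i. if i \<in> S then {1} else UNIV)"
      using S by (auto simp: Pi_def)
    then have "measure_pmf.prob Q {x. \<forall>i\<in>S. x i = 1} =
        (\<Prod>i\<in>{1..n}. measure_pmf.prob (map_pmf of_bool (bernoulli_pmf p) :: nat pmf)
                                     (if i \<in> S then {1} else UNIV))"
      unfolding Q_def by (simp add: measure_Pi_pmf_Pi)
    also have "\<dots> = (\<Prod>i\<in>{1..n}. if i \<in> S then p else 1)"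
    proof (rule prod.cong[OF refl])
      fix i
      have "of_bool -` {1::nat} = {True}" by (auto simp: of_bool_def split: if_splits)
      then have "measure_pmf.prob (map_pmf of_bool (bernoulli_pmf p)) {1::nat} = p"
        using assms unfolding measure_map_pmf by (simp add: measure_pmf_single)
      then show "measure_pmf.prob (map_pmf of_bool (bernoulli_pmf p) :: nat pmf)
                   (if i \<in> S then {1} else UNIV) = (if i \<in> S then p else 1)" by simp
    qed
    also have "\<dots> = (\<Prod>i\<in>S. p)"
      using S by (intro prod.mono_neutral_cong_right) auto
    finally show ?thesis by simp
  qed
  ultimately have "Q \<in> kwise_indep_dists n k p"
    by (auto simp: kwise_indep_dists_def)
  then show ?thesis by blast
qed

lemma prob_bit_vectors:
  assumes "set_pmf Q \<subseteq> bit_vectors n"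
  shows "measure_pmf.prob Q A = (\<Sum>x\<in>bit_vectors n \<inter> A. pmf Q x)"
proof -
  have "measure_pmf.prob Q A = measure_pmf.prob Q (bit_vectors n \<inter> A)"
    using assms by (intro measure_pmf.finite_measure_eq_AE) (auto simp: AE_measure_pmf_iff)
  then show ?thesis
    using finite_bit_vectors by (simp add: measure_measure_pmf_finite)
qed

lemma max_all_ones_attained:
  assumes "0 < p" "p < 1"
  shows "\<exists>Q\<in>kwise_indep_dists n k p.
           max_all_ones n k p = measure_pmf.prob Q {x. \<forall>i\<in>{1..n}. x i = 1} \<and>
           (\<forall>Q'\<in>kwise_indep_dists n k p.
              measure_pmf.prob Q' {x. \<forall>i\<in>{1..n}. x i = 1} \<le>
              measure_pmf.prob Q {x. \<forall>i\<in>{1..n}. x i = 1})"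
proof -
  let ?V = "bit_vectors n" and ?A = "\<lambda>S. {x::nat \<Rightarrow> nat. \<forall>i\<in>S. x i = 1}"
  define s where "s A f = (\<Sum>x\<in>?V \<inter> A. f x)" for A and f :: "(nat \<Rightarrow> nat) \<Rightarrow> real"
  define B where "B = (UNIV :: (nat \<Rightarrow> nat) set) \<rightarrow>\<^sub>E {0..1::real}"
  define K where "K = B \<inter> ({f. \<forall>x. x \<notin> ?V \<longrightarrow> f x = 0} \<inter> {f. s UNIV f = 1} \<inter>
    {f. \<forall>S. S \<subseteq> {1..n} \<and> card S \<le> k \<longrightarrow> s (?A S) f = p ^ card S})"
  have cont: "continuous_on X (s A)" for X A
    unfolding s_def by (intro continuous_intros continuous_on_product_coordinates)
      (auto intro: continuous_on_subset[OF continuous_on_product_coordinates])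
  have "compact B"
    unfolding B_def compactin_euclidean_iff[symmetric] euclidean_product_topology[symmetric]
    by (simp add: compactin_PiE)
  moreover have "closed ({f. \<forall>x. x \<notin> ?V \<longrightarrow> f x = 0} \<inter> {f. s UNIV f = 1} \<inter>
    {f. \<forall>S. S \<subseteq> {1..n} \<and> card S \<le> k \<longrightarrow> s (?A S) f = p ^ card S})"
    by (intro closed_Int closed_Collect_all closed_Collect_imp open_Collect_const
        closed_Collect_eq cont continuous_on_const continuous_on_product_coordinates)
  ultimately have "compact K"
    unfolding K_def by (rule compact_Int_closed)
  have pmf_K: "pmf Q \<in> K" if "Q \<in> kwise_indep_dists n k p" for Q
  proof -
    have V: "set_pmf Q \<subseteq> ?V"
      using that by (auto simp: kwise_indep_dists_def)
    have "s UNIV (pmf Q) = 1"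
      using prob_bit_vectors[OF V, of UNIV] by (simp add: s_def)
    moreover have "pmf Q x = 0" if "x \<notin> ?V" for x
      using V that by (auto simp: set_pmf_eq)
    ultimately show ?thesis
      using that by (auto simp: K_def B_def kwise_indep_dists_def s_def pmf_le_1 
          prob_bit_vectors[OF V])
  qed
  have K_pmf: "\<exists>Q\<in>kwise_indep_dists n k p. pmf Q = f" if "f \<in> K" for f
  proof -
    have nn: "0 \<le> f x" for x
      using that by (auto simp: K_def B_def)
    have z: "f x = 0" if "x \<notin> ?V" for x
      using that \<open>f \<in> K\<close> by (auto simp: K_def)
    have "(\<integral>\<^sup>+x. ennreal (f x) \<partial>count_space UNIV) = (\<Sum>x\<in>?V. ennreal (f x))"
      using z by (intro nn_integral_count_space'[OF finite_bit_vectors]) auto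
    also have "\<dots> = 1"
      using that nn by (simp add: K_def s_def sum_ennreal)
    finally have one: "(\<integral>\<^sup>+x. ennreal (f x) \<partial>count_space UNIV) = 1" .
    define Q where "Q = embed_pmf f"
    have Q: "pmf Q = f"
      unfolding Q_def using pmf_embed_pmf[of f] nn one by auto
    have V: "set_pmf Q \<subseteq> ?V"
      using z Q by (auto simp: set_pmf_eq)
    have "Q \<in> kwise_indep_dists n k p"
      using that V Q by (auto simp: kwise_indep_dists_def prob_bit_vectors[OF V] K_def s_def)
    then show ?thesis using Q by blast
  qed
  have "K \<noteq> {}"
    using kwise_indep_dists_nonempty[OF assms, of n k] pmf_K by blast
  then obtain f where f: "f \<in> K" "\<And>g. g \<in> K \<Longrightarrow> s (?A {1..n}) g \<le> s (?A {1..n}) f"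
    using continuous_attains_sup[OF \<open>compact K\<close> _ cont[of K "?A {1..n}"]] by blast
  obtain Q where Q: "Q \<in> kwise_indep_dists n k p" "pmf Q = f"
    using K_pmf f(1) by blast
  have s: "measure_pmf.prob Q' (?A {1..n}) = s (?A {1..n}) (pmf Q')"
    if "Q' \<in> kwise_indep_dists n k p" for Q'
    using that unfolding s_def by (intro prob_bit_vectors) (auto simp: kwise_indep_dists_def)
  have le: "measure_pmf.prob Q' (?A {1..n}) \<le> measure_pmf.prob Q (?A {1..n})"
    if "Q' \<in> kwise_indep_dists n k p" for Q'
    using f(2)[OF pmf_K[OF that]] Q by (simp only: s[OF that] s[OF Q(1)])
  have "max_all_ones n k p = measure_pmf.prob Q (?A {1..n})"
    unfolding max_all_ones_def using Q(1) le by (intro Greatest_equality) blast+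
  then show ?thesis using Q(1) le by blast
qed

end

theory Submission
  imports Defs
begin

text \<open>
  Put $d = k/2$, $q = 1 - p$ and $B = (p/q)^d / \binom{n}{d}$. The proof shows
  $B/4 \le M(n,k,p) \le B$ as soon as $16 k \le n p q$; a bound $k \le (\log N)^m$ or
  $k \le N^\beta$ implies this for large $N$, and comparing $\binom{n}{d}$ with $n^d/d!$ and
  $d!$ with $(d/e)^d$ turns $B$ into $(pk/(2e(1-p)n))^{k/2}$ up to the stated factors.

  A $k$-wise independent distribution gives a polynomial of degree at most $k$ in the number of
  ones the same expectation as the binomial law does. The upper bound tests this with the square
  of the Krawtchouk polynomial $K_d$: it is nonnegative, has degree $k$, binomial expectation
  $\binom{n}{d} (pq)^d$, and value $(\binom{n}{d} q^d)^2$ at $n$ (\<open>max_all_ones_le\<close>).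

  The lower bound uses linear programming duality (\<open>finite_moment_problem_solvable\<close>). It is
  enough to bound $P(n)$ by a multiple of the mean $E P$ of $P$ under the binomial law, for every
  polynomial $P$ of degree at most $k$ that is nonnegative at the integers $0, \dots, n$
  (\<open>value_at_n_le_mean\<close>). Moving $P$ along polynomials that vanish at $n$ and at the zeros
  already present, in a direction that does not increase $E P$, produces $k$ zeros among
  $0, \dots, n-1$ (\<open>descend_to_k_zeros\<close>). Nonnegativity forces these zeros to come in
  adjacent pairs $i, i+1$ (\<open>even_nonneg_zeros_paired\<close>), so that up to a constant
  $P(x) = g(x) g(x-1)$ with $g$ of degree $d$. This is the decisive point: $P$ is almost a square.
  In the Krawtchouk basis the backward difference has norm at most $1/2$ on polynomials of degree
  at most $d$ (\<open>back_diff_krawtchouk_sum\<close>), hence $E P \ge E g^2 / 2$, while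
  $P(n) \le g(n)^2$ and $g(n)^2$ is controlled by the Christoffel function of the
  binomial law (\<open>value_at_n_bound\<close>).
\<close>

section \<open>Bases of polynomials of bounded degree\<close>

lemma poly_in_span_of_degree_basis:
  fixes P :: "'a::field poly"
  assumes "\<And>j. j \<le> d \<Longrightarrow> degree (B j) = j" and "\<And>j. j \<le> d \<Longrightarrow> B j \<noteq> 0" and "degree P \<le> d"
  shows "\<exists>c. P = (\<Sum>j\<le>d. smult (c j) (B j))"
  using assms
proof (induction d arbitrary: P)
  case 0
  have "B 0 \<noteq> 0" "degree (B 0) = 0" using "0.prems"(1,2) by auto
  then obtain b where b: "B 0 = [:b:]" "b \<noteq> 0" by (metis degree_eq_zeroE pCons_0_0)
  obtain a where a: "P = [:a:]" using "0.prems"(3) by (metis degree_eq_zeroE le_zero_eq)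
  show ?case by (rule exI[of _ "\<lambda>_. a / b"]) (use a b in simp)
next
  case (Suc d)
  let ?l = "coeff P (Suc d) / coeff (B (Suc d)) (Suc d)"
  have deg: "degree (B (Suc d)) = Suc d" using Suc.prems(1) by simp
  have lc: "coeff (B (Suc d)) (Suc d) \<noteq> 0"
    by (metis Suc.prems(2) deg leading_coeff_0_iff order_refl)
  have "degree (P - smult ?l (B (Suc d))) \<le> d"
  proof (rule degree_le, intro allI impI)
    fix i assume i: "d < i"
    show "coeff (P - smult ?l (B (Suc d))) i = 0"
    proof (cases "i = Suc d")
      case True then show ?thesis using lc by simp
    next
      case False
      then have "Suc d < i" using i by simp
      then show ?thesis using Suc.prems(3) deg by (simp add: coeff_eq_0)
    qed
  qed
  then obtain c where c: "P - smult ?l (B (Suc d)) = (\<Sum>j\<le>d. smult (c j) (B j))"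
    using Suc.IH[of "P - smult ?l (B (Suc d))"] Suc.prems(1,2) by auto
  have "(\<Sum>j\<le>d. smult ((c(Suc d := ?l)) j) (B j)) = (\<Sum>j\<le>d. smult (c j) (B j))"
    by (rule sum.cong) auto
  then have "P = (\<Sum>j\<le>Suc d. smult ((c(Suc d := ?l)) j) (B j))"
    using c by (simp add: algebra_simps)
  then show ?case by blast
qed

text \<open>The polynomial $x (x-1) \cdots (x-i+1) / i!$. Expectations in this basis count $i$-subsets of
  the coordinates, which is the form in which $k$-wise independence is given.\<close>
definition binomial_poly :: "nat \<Rightarrow> real poly" where
  "binomial_poly i = smult (1 / fact i) (\<Prod>m<i. [:- real m, 1:])"

lemma poly_binomial_poly: "poly (binomial_poly i) (real x) = real (x choose i)"
  by (simp add: binomial_poly_def poly_prod binomial_gbinomial gbinomial_prod_rev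
        atLeast0LessThan)

lemma degree_binomial_poly: "degree (binomial_poly i) = i"
  unfolding binomial_poly_def by (simp add: degree_prod_eq_sum_degree)

lemma binomial_poly_nonzero: "binomial_poly i \<noteq> 0"
  unfolding binomial_poly_def by simp

section \<open>Krawtchouk polynomials\<close>

locale binomial_law =
  fixes n :: nat and p :: real
  assumes p_pos: "0 < p" and p_less_1: "p < 1"
begin

definition weight :: "nat \<Rightarrow> real" where
  "weight x = real (n choose x) * p ^ x * (1 - p) ^ (n - x)"

definition mean :: "(nat \<Rightarrow> real) \<Rightarrow> real" where
  "mean f = (\<Sum>x\<le>n. weight x * f x)"

text \<open>As $x$ varies, the coefficient of $t^j$ in $(1+(1-p)t)^x (1-pt)^{n-x}$ is a polynomial of
  degree $j$ in $x$, the Krawtchouk polynomial $K_j$. It is introduced through its generating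
  function since orthogonality and the behaviour under the shift $x \mapsto x - 1$ are immediate
  for the latter.\<close>
definition krawtchouk_gf :: "nat \<Rightarrow> real poly" where
  "krawtchouk_gf x = [:1, 1 - p:] ^ x * [:1, - p:] ^ (n - x)"

definition krawtchouk :: "nat \<Rightarrow> nat \<Rightarrow> real" where
  "krawtchouk j x = coeff (krawtchouk_gf x) j"

definition sq_norm :: "nat \<Rightarrow> real" where
  "sq_norm j = real (n choose j) * (p * (1 - p)) ^ j"

lemma weight_pos: "x \<le> n \<Longrightarrow> weight x > 0"
  using p_pos p_less_1 by (simp add: weight_def)

lemma sq_norm_pos: "j \<le> n \<Longrightarrow> sq_norm j > 0"
  using p_pos p_less_1 by (simp add: sq_norm_def)

lemma krawtchouk_generating:
  assumes "x \<le> n"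
  shows "(\<Sum>j\<le>n. krawtchouk j x * t ^ j) = (1 + (1 - p) * t) ^ x * (1 - p * t) ^ (n - x)"
proof -
  have "degree (krawtchouk_gf x) \<le> degree ([:1, 1 - p:] ^ x) + degree ([:1, - p:] ^ (n - x))"
    unfolding krawtchouk_gf_def by (rule degree_mult_le)
  also have "\<dots> \<le> x + (n - x)"
    by (intro add_mono order_trans[OF degree_power_le]) (auto split: if_splits)
  finally have "degree (krawtchouk_gf x) \<le> n" using assms by simp
  then have "poly (krawtchouk_gf x) t = (\<Sum>j\<le>n. krawtchouk j x * t ^ j)"
    unfolding krawtchouk_def poly_altdef
    by (intro sum.mono_neutral_left) (auto simp: coeff_eq_0 not_le)
  then show ?thesis by (simp add: krawtchouk_gf_def mult.commute)
qed

text \<open>With $q = 1 - p$, the mean of the product of the generating functions at $t$ and $s$ is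
  $(p(1+qt)(1+qs) + q(1-pt)(1-ps))^n = (1 + pqts)^n$, in which only equal powers of
  $t$ and $s$ occur.\<close>
lemma krawtchouk_orthogonal:
  assumes "i \<le> n" "j \<le> n"
  shows "mean (\<lambda>x. krawtchouk i x * krawtchouk j x) = (if i = j then sq_norm i else 0)"
proof -
  define a where "a i j = mean (\<lambda>x. krawtchouk i x * krawtchouk j x)" for i j
  have two: "(\<Sum>i\<le>n. (\<Sum>j\<le>n. a i j * s ^ j) * t ^ i) = (\<Sum>i\<le>n. (sq_norm i * s ^ i) * t ^ i)" for s t
  proof -
    have "(\<Sum>i\<le>n. (\<Sum>j\<le>n. a i j * s ^ j) * t ^ i) =
      (\<Sum>i\<le>n. \<Sum>j\<le>n. \<Sum>x\<le>n. weight x * (krawtchouk i x * t ^ i) * (krawtchouk j x * s ^ j))"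
      unfolding a_def mean_def sum_distrib_right sum_distrib_left
      by (intro sum.cong refl) (simp add: mult_ac)
    also have "\<dots> = (\<Sum>i\<le>n. \<Sum>x\<le>n. \<Sum>j\<le>n. weight x * (krawtchouk i x * t ^ i) * (krawtchouk j x * s ^ j))"
      by (rule sum.cong[OF refl], rule sum.swap)
    also have "\<dots> = (\<Sum>x\<le>n. \<Sum>i\<le>n. \<Sum>j\<le>n. weight x * (krawtchouk i x * t ^ i) * (krawtchouk j x * s ^ j))"
      by (rule sum.swap)
    also have "\<dots> = (\<Sum>x\<le>n. weight x * (\<Sum>i\<le>n. krawtchouk i x * t ^ i) * (\<Sum>j\<le>n. krawtchouk j x * s ^ j))"
      by (simp add: sum_distrib_left sum_distrib_right mult_ac)
    also have "\<dots> = (\<Sum>x\<le>n. weight x * ((1 + (1 - p) * t) ^ x * (1 - p * t) ^ (n - x)) *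
        ((1 + (1 - p) * s) ^ x * (1 - p * s) ^ (n - x)))"
      by (rule sum.cong) (simp_all add: krawtchouk_generating)
    also have "\<dots> = (\<Sum>x\<le>n. real (n choose x) * (p * (1 + (1 - p) * t) * (1 + (1 - p) * s)) ^ x *
         ((1 - p) * (1 - p * t) * (1 - p * s)) ^ (n - x))"
      by (rule sum.cong) (simp_all add: weight_def power_mult_distrib mult_ac)
    also have "\<dots> = (p * (1 + (1 - p) * t) * (1 + (1 - p) * s) + (1 - p) * (1 - p * t) * (1 - p * s)) ^ n"
      by (simp add: binomial_ring)
    also have "\<dots> = (p * (1 - p) * s * t + 1) ^ n"
      by (rule arg_cong[where f = "\<lambda>z. z ^ n"]) (simp add: algebra_simps)
    also have "\<dots> = (\<Sum>i\<le>n. (sq_norm i * s ^ i) * t ^ i)"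
      by (subst binomial_ring) (simp add: sq_norm_def power_mult_distrib mult_ac)
    finally show ?thesis .
  qed
  have one: "(\<Sum>j\<le>n. a i j * s ^ j) = sq_norm i * s ^ i" for s
    using two[of s] assms(1) polyfun_eq_coeffs[of "\<lambda>i. \<Sum>j\<le>n. a i j * s ^ j" n "\<lambda>i. sq_norm i * s ^ i"]
    by simp
  have "sq_norm i * s ^ i = (\<Sum>j\<le>n. (if i = j then sq_norm i else 0) * s ^ j)" for s
  proof -
    have "(\<Sum>j\<le>n. (if i = j then sq_norm i else 0) * s ^ j) =
        (\<Sum>j\<le>n. if j = i then sq_norm j * s ^ j else 0)"
      by (rule sum.cong) auto
    then show ?thesis using assms(1) by simp
  qed
  then have "\<forall>j\<le>n. a i j = (if i = j then sq_norm i else 0)"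
    using one polyfun_eq_coeffs[of "a i" n "\<lambda>j. if i = j then sq_norm i else 0"] by simp
  then show ?thesis using assms(2) by (simp add: a_def)
qed

lemma krawtchouk_at_n: "j \<le> n \<Longrightarrow> krawtchouk j n = real (n choose j) * (1 - p) ^ j"
  by (simp add: krawtchouk_def krawtchouk_gf_def coeff_linear_poly_power)

text \<open>The generating functions $G_x$ satisfy $(1 - pt) G_x = (1 + (1-p)t) G_{x-1}$, that is,
  $(1 + (1-p) t)(G_x - G_{x-1}) = t G_x$. The equations compare the coefficients of both sides.
  So the backward difference is the index shift $K_{j+1} \mapsto K_j$ up to a multiple of
  itself at lower degree.\<close>
lemma krawtchouk_shift:
  assumes "1 \<le> x" "x \<le> n"
  shows "krawtchouk 0 x - krawtchouk 0 (x - 1) = 0" (is ?zero)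
    and "(krawtchouk (Suc j) x - krawtchouk (Suc j) (x - 1)) +
         (1 - p) * (krawtchouk j x - krawtchouk j (x - 1)) = krawtchouk j x" (is ?suc)
proof -
  have "krawtchouk_gf x * [:1, - p:] = krawtchouk_gf (x - 1) * [:1, 1 - p:]"
  proof -
    have "[:1, 1 - p:] ^ x = [:1, 1 - p:] * [:1, 1 - p:] ^ (x - 1)"
      using assms by (cases x) auto
    moreover have "[:1, - p:] ^ (n - (x - 1)) = [:1, - p:] * [:1, - p:] ^ (n - x)"
    proof -
      have "n - (x - 1) = Suc (n - x)" using assms by simp
      then show ?thesis by (simp only: power_Suc)
    qed
    ultimately show ?thesis unfolding krawtchouk_gf_def by (simp only: mult_ac)
  qed
  then have eq: "coeff (krawtchouk_gf x * [:1, - p:]) i = coeff (krawtchouk_gf (x - 1) * [:1, 1 - p:]) i" for i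
    by simp
  show ?zero using eq[of 0] by (simp add: krawtchouk_def coeff_mult)
  have "coeff (krawtchouk_gf y * [:1, b:]) (Suc j) = krawtchouk (Suc j) y + b * krawtchouk j y" for y b
    by (simp add: krawtchouk_def mult_pCons_right)
  then have "krawtchouk (Suc j) x - p * krawtchouk j x =
      krawtchouk (Suc j) (x - 1) + (1 - p) * krawtchouk j (x - 1)"
    using eq[of "Suc j"] by (metis (no_types) add_uminus_conv_diff mult_minus_left)
  then show ?suc by (simp add: algebra_simps)
qed

text \<open>$K_j$ as a polynomial in $x$, read off from the generating function by writing
  $1 + (1-p)t = t + (1 - pt)$ and expanding the $x$-th power.\<close>
definition krawtchouk_poly :: "nat \<Rightarrow> real poly" where
  "krawtchouk_poly j =
     (\<Sum>i\<le>j. smult (coeff ([:1, - p:] ^ (n - i)) (j - i)) (binomial_poly i))"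

lemma poly_krawtchouk_poly:
  assumes "x \<le> n"
  shows "poly (krawtchouk_poly j) (real x) = krawtchouk j x"
proof -
  let ?b = "[:1, - p:]"
  have "[:1, 1 - p:] = [:0, 1:] + ?b" by simp
  then have "krawtchouk_gf x = (\<Sum>i\<le>x. of_nat (x choose i) * [:0, 1:] ^ i * ?b ^ (x - i)) * ?b ^ (n - x)"
    unfolding krawtchouk_gf_def by (simp only: binomial_ring)
  also have "\<dots> = (\<Sum>i\<le>x. smult (real (x choose i)) (monom 1 i * ?b ^ (n - i)))"
    unfolding sum_distrib_right
  proof (rule sum.cong[OF refl])
    fix i assume "i \<in> {..x}"
    then have "?b ^ (n - i) = ?b ^ (x - i) * ?b ^ (n - x)"
      using assms by (simp flip: power_add)
    then show "of_nat (x choose i) * [:0, 1:] ^ i * ?b ^ (x - i) * ?b ^ (n - x) =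
        smult (real (x choose i)) (monom 1 i * ?b ^ (n - i))"
      by (simp add: of_nat_poly monom_altdef mult_ac)
  qed
  finally have "krawtchouk j x = (\<Sum>i\<le>x. real (x choose i) * (if i \<le> j then coeff (?b ^ (n - i)) (j - i) else 0))"
    by (auto simp: krawtchouk_def coeff_sum coeff_monom_mult intro!: sum.cong)
  also have "\<dots> = (\<Sum>i\<in>{..j}. real (x choose i) * coeff (?b ^ (n - i)) (j - i))"
    by (rule sum.mono_neutral_cong) auto
  finally show ?thesis
    by (simp add: krawtchouk_poly_def poly_sum poly_binomial_poly mult.commute)
qed

lemma degree_krawtchouk_poly: "degree (krawtchouk_poly j) = j"
  and krawtchouk_poly_nonzero: "krawtchouk_poly j \<noteq> 0"
proof -
  have c: "coeff (binomial_poly j) j \<noteq> 0"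
    using binomial_poly_nonzero[of j] degree_binomial_poly[of j] by (metis leading_coeff_0_iff)
  have "coeff (krawtchouk_poly j) j =
     (\<Sum>i\<le>j. coeff ([:1, - p:] ^ (n - i)) (j - i) * coeff (binomial_poly i) j)"
    by (simp add: krawtchouk_poly_def coeff_sum)
  also have "\<dots> = (\<Sum>i\<in>{j}. coeff ([:1, - p:] ^ (n - i)) (j - i) * coeff (binomial_poly i) j)"
    by (rule sum.mono_neutral_right) (auto simp: coeff_eq_0 degree_binomial_poly)
  also have "\<dots> \<noteq> 0" using c by (simp add: coeff_0_power)
  finally have "coeff (krawtchouk_poly j) j \<noteq> 0" .
  moreover have "degree (krawtchouk_poly j) \<le> j"
    unfolding krawtchouk_poly_def
    by (intro degree_sum_le order_trans[OF degree_smult_le]) (auto simp: degree_binomial_poly)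
  ultimately show "degree (krawtchouk_poly j) = j" "krawtchouk_poly j \<noteq> 0"
    by (auto simp: le_antisym le_degree)
qed

section \<open>The backward difference and the value at the endpoint\<close>

text \<open>The norm of the space of square integrable functions of the binomial law.\<close>
definition wnorm :: "(nat \<Rightarrow> real) \<Rightarrow> real" where
  "wnorm f = L2_set (\<lambda>x. sqrt (weight x) * f x) {..n}"

lemma wnorm_nonneg: "wnorm f \<ge> 0"
  by (simp add: wnorm_def L2_set_nonneg)

lemma sqrt_weight_squared: "x \<le> n \<Longrightarrow> sqrt (weight x) * sqrt (weight x) = weight x"
  using weight_pos[of x] by simp

lemma wnorm_squared: "(wnorm f)\<^sup>2 = mean (\<lambda>x. (f x)\<^sup>2)"
  unfolding wnorm_def mean_def L2_set_def
  by (subst real_sqrt_pow2)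
     (auto intro!: sum_nonneg sum.cong simp: power_mult_distrib weight_pos less_imp_le)

lemma wnorm_triangle: "wnorm (\<lambda>x. f x + g x) \<le> wnorm f + wnorm g"
  unfolding wnorm_def distrib_left by (rule L2_set_triangle_ineq)

lemma wnorm_scale: "wnorm (\<lambda>x. a * f x) = \<bar>a\<bar> * wnorm f"
proof -
  have "wnorm (\<lambda>x. a * f x) = L2_set (\<lambda>x. \<bar>a\<bar> * (sqrt (weight x) * \<bar>f x\<bar>)) {..n}"
    unfolding wnorm_def L2_set_def by (simp add: power_mult_distrib mult_ac)
  also have "\<dots> = \<bar>a\<bar> * wnorm f"
    unfolding wnorm_def L2_set_def
    by (simp add: power_mult_distrib real_sqrt_mult flip: sum_distrib_left)
  finally show ?thesis .
qed

lemma wnorm_mono: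
  assumes "\<And>x. x \<le> n \<Longrightarrow> \<bar>f x\<bar> \<le> \<bar>g x\<bar>"
  shows "wnorm f \<le> wnorm g"
  unfolding wnorm_def L2_set_def
  by (intro real_sqrt_le_mono sum_mono)
     (auto simp: power_mult_distrib intro!: mult_left_mono less_imp_le[OF weight_pos]
        assms[unfolded abs_le_square_iff])

lemma mean_product_le: "mean (\<lambda>x. f x * g x) \<le> wnorm f * wnorm g"
proof -
  have "mean (\<lambda>x. f x * g x) =
      (\<Sum>x\<le>n. (sqrt (weight x) * f x) * (sqrt (weight x) * g x))"
    unfolding mean_def
    by (rule sum.cong[OF refl])
       (metis (no_types) atMost_iff mult.assoc mult.left_commute sqrt_weight_squared)
  also have "\<dots> \<le> (\<Sum>x\<le>n. \<bar>sqrt (weight x) * f x\<bar> * \<bar>sqrt (weight x) * g x\<bar>)"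
    by (rule sum_mono) (metis abs_ge_self abs_mult)
  also have "\<dots> \<le> wnorm f * wnorm g"
    unfolding wnorm_def by (rule L2_set_mult_ineq)
  finally show ?thesis .
qed

definition krawtchouk_sum :: "(nat \<Rightarrow> real) \<Rightarrow> nat \<Rightarrow> nat \<Rightarrow> real" where
  "krawtchouk_sum c d x = (\<Sum>j\<le>d. c j * krawtchouk j x)"

lemma parseval:
  assumes "d \<le> n"
  shows "(wnorm (krawtchouk_sum c d))\<^sup>2 = (\<Sum>j\<le>d. (c j)\<^sup>2 * sq_norm j)"
proof -
  have "(wnorm (krawtchouk_sum c d))\<^sup>2 =
      (\<Sum>x\<le>n. \<Sum>i\<le>d. \<Sum>j\<le>d. c i * c j * (weight x * (krawtchouk i x * krawtchouk j x)))"
    unfolding wnorm_squared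
    by (simp add: mean_def krawtchouk_sum_def power2_eq_square sum_product sum_distrib_left mult_ac)
  also have "\<dots> = (\<Sum>i\<le>d. \<Sum>x\<le>n. \<Sum>j\<le>d. c i * c j * (weight x * (krawtchouk i x * krawtchouk j x)))"
    by (rule sum.swap)
  also have "\<dots> = (\<Sum>i\<le>d. \<Sum>j\<le>d. \<Sum>x\<le>n. c i * c j * (weight x * (krawtchouk i x * krawtchouk j x)))"
    by (rule sum.cong[OF refl], rule sum.swap)
  also have "\<dots> = (\<Sum>i\<le>d. \<Sum>j\<le>d. if i = j then (c i)\<^sup>2 * sq_norm i else 0)"
    using assms krawtchouk_orthogonal
    by (intro sum.cong refl) (simp add: mean_def power2_eq_square flip: sum_distrib_left)
  finally show ?thesis by simp
qed

text \<open>The value $0$ at $x = 0$ keeps the operator on functions on $\{0, \dots, n\}$; the shift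
  identity is available for $x \ge 1$, and setting one value to $0$ does not increase a norm.\<close>
definition back_diff :: "(nat \<Rightarrow> real) \<Rightarrow> nat \<Rightarrow> real" where
  "back_diff f x = (if x = 0 then 0 else f x - f (x - 1))"

text \<open>The index shift $S$ with $S K_{j+1} = K_j$ has norm at most $e$ on the span of
  $K_0, \dots, K_d$, by the hypothesis on the norms of the $K_j$. By the shift identity the
  difference operator $\nabla$ satisfies $\nabla g + (1-p) \nabla (S g) = S g$ for
  $x \ge 1$. As $S$ lowers the degree, the bound follows by induction:
  $\|\nabla g\| \le \|S g\| + 2 e \|S g\| \le 2 \|S g\|$.\<close>
lemma back_diff_krawtchouk_sum:
  assumes "d \<le> n" "0 \<le> e" "e \<le> 1 / 2"
    and "\<And>j. j < d \<Longrightarrow> sq_norm j \<le> e\<^sup>2 * sq_norm (Suc j)"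
  shows "wnorm (back_diff (krawtchouk_sum c d)) \<le> 2 * e * wnorm (krawtchouk_sum c d)"
  using assms
proof (induction d arbitrary: c)
  case 0
  have "\<bar>back_diff (krawtchouk_sum c 0) x\<bar> \<le> \<bar>0 * krawtchouk_sum c 0 x\<bar>" if "x \<le> n" for x
    using krawtchouk_shift(1)[of x] that
    by (cases "x = 0") (simp_all add: back_diff_def krawtchouk_sum_def)
  then have "wnorm (back_diff (krawtchouk_sum c 0)) \<le> wnorm (\<lambda>x. 0 * krawtchouk_sum c 0 x)"
    by (rule wnorm_mono)
  also have "\<dots> = 0" by (subst wnorm_scale) simp
  also have "0 \<le> 2 * e * wnorm (krawtchouk_sum c 0)"
    using 0 wnorm_nonneg by simp
  finally show ?case .
next
  case (Suc d)
  define g where "g = krawtchouk_sum c (Suc d)"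
  define s where "s = krawtchouk_sum (\<lambda>j. c (Suc j)) d"
  have shift: "back_diff g x = (if x = 0 then 0 else s x) + - (1 - p) * back_diff s x"
    if "x \<le> n" for x
  proof (cases "x = 0")
    case False
    have "back_diff g x = (\<Sum>j\<le>Suc d. c j * (krawtchouk j x - krawtchouk j (x - 1)))"
      using False by (simp add: back_diff_def g_def krawtchouk_sum_def right_diff_distrib
          del: sum.atMost_Suc flip: sum_subtractf)
    also have "\<dots> = (\<Sum>j\<le>d. c (Suc j) * (krawtchouk (Suc j) x - krawtchouk (Suc j) (x - 1)))"
      using krawtchouk_shift(1)[of x] False that
      by (subst sum.atMost_Suc_shift) (simp add: Suc_leI)
    also have "\<dots> = (\<Sum>j\<le>d. c (Suc j) * (krawtchouk j x - (1 - p) * (krawtchouk j x - krawtchouk j (x - 1))))"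
      using krawtchouk_shift(2)[of x] False that
      by (intro sum.cong refl) (simp add: Suc_leI eq_diff_eq)
    also have "\<dots> = s x + - (1 - p) * back_diff s x"
      using False
      by (simp add: back_diff_def s_def krawtchouk_sum_def sum_subtractf sum_distrib_left
          right_diff_distrib left_diff_distrib algebra_simps sum.distrib)
    finally show ?thesis using False by simp
  qed (simp add: back_diff_def)
  have s_le: "wnorm s \<le> e * wnorm g"
  proof -
    have "(wnorm s)\<^sup>2 = (\<Sum>j\<le>d. (c (Suc j))\<^sup>2 * sq_norm j)"
      unfolding s_def using Suc.prems(1) by (simp add: parseval)
    also have "\<dots> \<le> (\<Sum>j\<le>d. (c (Suc j))\<^sup>2 * (e\<^sup>2 * sq_norm (Suc j)))"
      using Suc.prems(4) by (intro sum_mono mult_left_mono) auto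
    also have "\<dots> = e\<^sup>2 * (\<Sum>j\<le>d. (c (Suc j))\<^sup>2 * sq_norm (Suc j))"
      by (simp add: sum_distrib_left mult_ac)
    also have "\<dots> \<le> e\<^sup>2 * (\<Sum>j\<le>Suc d. (c j)\<^sup>2 * sq_norm j)"
      by (subst sum.atMost_Suc_shift) (simp add: distrib_left less_imp_le sq_norm_pos)
    also have "\<dots> = (e * wnorm g)\<^sup>2"
      unfolding g_def power_mult_distrib using Suc.prems(1) by (simp only: parseval)
    finally show ?thesis
      by (rule power2_le_imp_le) (use Suc.prems(2) wnorm_nonneg in simp)
  qed
  have "wnorm (back_diff g) \<le> wnorm (\<lambda>x. (if x = 0 then 0 else s x) + - (1 - p) * back_diff s x)"
    by (rule wnorm_mono) (simp only: shift order_refl)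
  also have "\<dots> \<le> wnorm (\<lambda>x. if x = 0 then 0 else s x) + wnorm (\<lambda>x. - (1 - p) * back_diff s x)"
    by (rule wnorm_triangle)
  also have "\<dots> \<le> wnorm s + 1 * wnorm (back_diff s)"
    unfolding wnorm_scale using p_pos p_less_1 wnorm_nonneg
    by (intro add_mono wnorm_mono mult_right_mono) auto
  also have "\<dots> \<le> wnorm s + 1 * wnorm s"
  proof -
    have "wnorm (back_diff s) \<le> 2 * e * wnorm s"
      unfolding s_def using Suc.prems by (intro Suc.IH) auto
    also have "\<dots> \<le> 1 * wnorm s"
      using Suc.prems(3) wnorm_nonneg by (intro mult_right_mono) auto
    finally show ?thesis by simp
  qed
  also have "\<dots> \<le> 2 * e * wnorm g" using s_le by simp
  finally show ?case by (simp add: g_def)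
qed

text \<open>The sum of $K_j(n)^2 / \|K_j\|^2$ for $j \le d$, that is, the reciprocal of the Christoffel
  function at $n$. The $j$-th term equals $\binom{n}{j} ((1-p)/p)^j$.\<close>
definition christoffel :: "nat \<Rightarrow> real" where
  "christoffel d = (\<Sum>j\<le>d. sq_norm j / p ^ (2 * j))"

lemma krawtchouk_at_n_squared: "j \<le> n \<Longrightarrow> (krawtchouk j n)\<^sup>2 = sq_norm j * (sq_norm j / p ^ (2 * j))"
  using p_pos
  by (simp add: krawtchouk_at_n sq_norm_def power_mult_distrib mult_2 power_add power2_eq_square)

text \<open>Cauchy-Schwarz for the expansion of a polynomial of degree at most $d$ in the orthogonal
  basis.\<close>
lemma value_at_n_bound:
  assumes "d \<le> n"
  shows "(krawtchouk_sum c d n)\<^sup>2 \<le> christoffel d * (wnorm (krawtchouk_sum c d))\<^sup>2"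
proof -
  have pos: "sq_norm j > 0" if "j \<le> d" for j using that assms by (simp add: sq_norm_pos)
  have "krawtchouk_sum c d n = (\<Sum>j\<le>d. (krawtchouk j n / sqrt (sq_norm j)) * (c j * sqrt (sq_norm j)))"
    unfolding krawtchouk_sum_def using pos by (intro sum.cong refl) (simp add: mult.commute less_imp_neq[symmetric])
  then have "(krawtchouk_sum c d n)\<^sup>2 \<le>
      (\<Sum>j\<le>d. (krawtchouk j n / sqrt (sq_norm j))\<^sup>2) * (\<Sum>j\<le>d. (c j * sqrt (sq_norm j))\<^sup>2)"
    by (simp only: Cauchy_Schwarz_ineq_sum)
  also have "(\<Sum>j\<le>d. (c j * sqrt (sq_norm j))\<^sup>2) = (wnorm (krawtchouk_sum c d))\<^sup>2"
    unfolding parseval[OF assms] using pos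
    by (intro sum.cong refl) (simp add: power_mult_distrib less_imp_le)
  also have "(\<Sum>j\<le>d. (krawtchouk j n / sqrt (sq_norm j))\<^sup>2) = christoffel d"
    unfolding christoffel_def using pos assms
    by (intro sum.cong refl)
       (simp add: power_divide krawtchouk_at_n_squared less_imp_le less_imp_neq[symmetric])
  finally show ?thesis .
qed

lemma sq_norm_ratio:
  assumes "j < d" "d \<le> n" and small: "16 * real d \<le> real (n - d) * p * (1 - p)"
  shows "sq_norm j \<le> (1 / 4)\<^sup>2 * sq_norm (Suc j)"
proof -
  have pq: "p * (1 - p) > 0" using p_pos p_less_1 by simp
  have "real (Suc j) * real (n choose Suc j) = real (n - j) * real (n choose j)"
    using binomial_absorb_comp[of n j] binomial_absorption[of j n] by (metis of_nat_mult)
  moreover have "real (Suc j) * sq_norm (Suc j) =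
      (real (Suc j) * real (n choose Suc j)) * (p * (1 - p)) * (p * (1 - p)) ^ j"
    by (simp only: sq_norm_def power_Suc mult.assoc)
  ultimately have eq: "real (Suc j) * sq_norm (Suc j) = (real (n - j) * (p * (1 - p))) * sq_norm j"
    by (simp only: sq_norm_def) (simp only: mult_ac)
  have "16 * real (Suc j) \<le> 16 * real d" using assms by simp
  also have "\<dots> \<le> real (n - d) * (p * (1 - p))" using small by (simp only: mult.assoc)
  also have "\<dots> \<le> real (n - j) * (p * (1 - p))"
    using assms pq by (intro mult_right_mono) auto
  finally have "16 * real (Suc j) * sq_norm j \<le> real (Suc j) * sq_norm (Suc j)"
    unfolding eq using sq_norm_pos[of j] assms by (intro mult_right_mono) auto
  then have "real (Suc j) * (16 * sq_norm j) \<le> real (Suc j) * sq_norm (Suc j)" by (simp only: mult_ac)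
  then show ?thesis by (simp add: power2_eq_square)
qed

text \<open>Each term of the sum is at most half of the next one, so the sum is dominated by its last
  term.\<close>
lemma christoffel_le:
  assumes "d \<le> n" "16 * real d \<le> real (n - d) * p * (1 - p)"
  shows "christoffel d \<le> 2 * (sq_norm d / p ^ (2 * d))"
proof -
  have "christoffel i \<le> 2 * (sq_norm i / p ^ (2 * i))" if "i \<le> d" for i
    using that
  proof (induction i)
    case 0
    then show ?case by (simp add: christoffel_def sq_norm_def)
  next
    case (Suc i)
    have "p * p \<le> 1" using p_pos p_less_1 by (simp add: mult_le_one)
    then have "sq_norm i * (p * p) \<le> sq_norm i * 1"
      using Suc.prems assms sq_norm_pos[of i] by (intro mult_left_mono) auto
    also have "\<dots> \<le> sq_norm (Suc i) / 2"
      using sq_norm_ratio[of i d] Suc.prems assms sq_norm_pos[of "Suc i"] by (simp add: power2_eq_square)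
    finally have "sq_norm i / p ^ (2 * i) \<le> (sq_norm (Suc i) / 2) / p ^ (2 * Suc i)"
      using p_pos by (simp add: field_simps)
    moreover have "christoffel (Suc i) = christoffel i + sq_norm (Suc i) / p ^ (2 * Suc i)"
      by (simp add: christoffel_def)
    moreover have "christoffel i \<le> 2 * (sq_norm i / p ^ (2 * i))"
      using Suc by simp
    moreover have "sq_norm (Suc i) / 2 / p ^ (2 * Suc i) = (sq_norm (Suc i) / p ^ (2 * Suc i)) / 2"
      by simp
    ultimately show ?case by linarith
  qed
  then show ?thesis by simp
qed

end

section \<open>Polynomials that are nonnegative at integers\<close>

text \<open>Let $D$ be the product of $x - z$ over the zeros $z < n$ of $P$ and $z = n$. Adding a
  multiple of $D$ to $P$ changes neither these zeros nor the value at $n$. With the sign chosen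
  such that the weighted sum does not increase, the direction is negative at some integer
  point, because all weights are positive
  and $D$ has at most $k \le n$ zeros; going along it until $P$ first vanishes at such a
  point gives a new zero.\<close>
lemma descend_to_more_zeros:
  fixes w :: "nat \<Rightarrow> real" and P :: "real poly"
  assumes w: "\<And>x. x \<le> n \<Longrightarrow> w x > 0" and kn: "k < n"
    and deg: "degree P \<le> k" and nonneg: "\<And>x. x \<le> n \<Longrightarrow> poly P (real x) \<ge> 0"
    and few: "card {z. z < n \<and> poly P (real z) = 0} < k"
  shows "\<exists>P'. degree P' \<le> k \<and> (\<forall>x\<le>n. poly P' (real x) \<ge> 0) \<and> poly P' (real n) = poly P (real n) \<and>
    (\<Sum>x\<le>n. w x * poly P' (real x)) \<le> (\<Sum>x\<le>n. w x * poly P (real x)) \<and>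
    card {z. z < n \<and> poly P (real z) = 0} < card {z. z < n \<and> poly P' (real z) = 0}"
proof -
  let ?L = "\<lambda>P. \<Sum>x\<le>n. w x * poly P (real x)"
  define Z where "Z = {z. z < n \<and> poly P (real z) = 0}"
  have fin: "finite Z" by (simp add: Z_def)
  define D where "D = (\<Prod>z\<in>insert n Z. [:- real z, 1:])"
  have nZ: "n \<notin> Z" by (simp add: Z_def)
  have degD: "degree D = Suc (card Z)"
    unfolding D_def using fin nZ by (subst degree_prod_eq_sum_degree) auto
  have D_zero: "poly D (real x) = 0 \<longleftrightarrow> x \<in> insert n Z" for x
    unfolding D_def poly_prod using fin by (auto simp: prod_zero_iff)
  define E where "E = (if ?L D \<le> 0 then D else - D)"
  have L_minus: "?L (- D) = - ?L D" by (simp add: sum_negf)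
  have LE: "?L E \<le> 0" using L_minus by (simp add: E_def)
  have E_zero: "poly E (real x) = 0 \<longleftrightarrow> x \<in> insert n Z" for x
    using D_zero by (simp add: E_def)
  have degE: "degree E \<le> k" using degD few by (simp add: E_def Z_def)
  define N where "N = {y. y \<le> n \<and> poly E (real y) < 0}"
  have "N \<noteq> {}"
  proof
    assume "N = {}"
    then have nn: "poly E (real y) \<ge> 0" if "y \<le> n" for y
      using that unfolding N_def by (metis (mono_tags, lifting) empty_iff mem_Collect_eq not_le)
    have "card (insert n Z) < card {..n}"
      using few kn fin nZ by (simp add: Z_def)
    then obtain y where y: "y \<le> n" "y \<notin> insert n Z"
      by (metis atMost_iff card_mono fin finite_insert not_le subsetI)
    have "0 < ?L E"
      using y nn w E_zero[of y]
      by (intro sum_pos2[of _ y]) (auto intro!: mult_pos_pos mult_nonneg_nonneg simp: less_le)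
    then show False using LE by simp
  qed
  \<comment> \<open>The largest step that keeps the polynomial nonnegative is a minimum of ratios.\<close>
  define r where "r y = poly P (real y) / - poly E (real y)" for y
  define t where "t = Min (r ` N)"
  have finN: "finite N" by (simp add: N_def)
  have "t \<in> r ` N" unfolding t_def using finN \<open>N \<noteq> {}\<close> by (intro Min_in) auto
  then obtain y where y: "y \<in> N" "t = r y" by auto
  have t_le: "t \<le> r x" if "x \<in> N" for x unfolding t_def using that finN by simp
  have t0: "t \<ge> 0" unfolding y(2) r_def using y(1) nonneg by (intro divide_nonneg_pos) (auto simp: N_def)
  define P' where "P' = P + smult t E"
  have "degree P' \<le> k"
    unfolding P'_def using deg degE by (intro degree_add_le order_trans[OF degree_smult_le]) auto
  moreover have "poly P' (real x) \<ge> 0" if "x \<le> n" for x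
  proof (cases "x \<in> N")
    case True
    then have "t * - poly E (real x) \<le> poly P (real x)"
      using t_le[OF True] pos_le_divide_eq[of "- poly E (real x)" t "poly P (real x)"] True
      by (simp only: r_def N_def mem_Collect_eq neg_0_less_iff_less)
    then show ?thesis by (simp add: P'_def)
  next
    case False
    then show ?thesis using that nonneg t0 by (simp add: P'_def N_def)
  qed
  moreover have "poly P' (real n) = poly P (real n)" using E_zero[of n] by (simp add: P'_def)
  moreover have "?L P' \<le> ?L P"
  proof -
    have "?L P' = ?L P + t * ?L E"
      by (simp add: P'_def distrib_left sum.distrib sum_distrib_left mult_ac)
    then show ?thesis using LE t0 by (simp add: mult_nonneg_nonpos)
  qed
  moreover have "card Z < card {z. z < n \<and> poly P' (real z) = 0}"
  proof (rule psubset_card_mono)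
    have "Z \<subseteq> {z. z < n \<and> poly P' (real z) = 0}"
      using E_zero by (auto simp: Z_def P'_def)
    moreover have "y < n" "y \<notin> Z" using y(1) E_zero[of y] E_zero[of n]
      by (auto simp: N_def less_le)
    moreover have "poly P' (real y) = 0"
      using y by (simp add: P'_def r_def N_def)
    ultimately show "Z \<subset> {z. z < n \<and> poly P' (real z) = 0}" by blast
  qed simp
  ultimately show ?thesis unfolding Z_def by blast
qed

lemma descend_to_k_zeros:
  fixes w :: "nat \<Rightarrow> real" and P :: "real poly"
  assumes w: "\<And>x. x \<le> n \<Longrightarrow> w x > 0" and kn: "k < n"
    and "degree P \<le> k" and "\<And>x. x \<le> n \<Longrightarrow> poly P (real x) \<ge> 0"
  shows "\<exists>P'. degree P' \<le> k \<and> (\<forall>x\<le>n. poly P' (real x) \<ge> 0) \<and> poly P' (real n) = poly P (real n) \<and>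
    (\<Sum>x\<le>n. w x * poly P' (real x)) \<le> (\<Sum>x\<le>n. w x * poly P (real x)) \<and>
    k \<le> card {z. z < n \<and> poly P' (real z) = 0}"
  using assms(3,4)
proof (induction "k - card {z. z < n \<and> poly P (real z) = 0}" arbitrary: P rule: less_induct)
  case less
  show ?case
  proof (cases "card {z. z < n \<and> poly P (real z) = 0} < k")
    case True
    obtain P1 where P1: "degree P1 \<le> k" "\<forall>x\<le>n. poly P1 (real x) \<ge> 0" "poly P1 (real n) = poly P (real n)"
      "(\<Sum>x\<le>n. w x * poly P1 (real x)) \<le> (\<Sum>x\<le>n. w x * poly P (real x))"
      "card {z. z < n \<and> poly P (real z) = 0} < card {z. z < n \<and> poly P1 (real z) = 0}"
      using descend_to_more_zeros[where w = w, OF w kn less.prems True] by blast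
    have "k - card {z. z < n \<and> poly P1 (real z) = 0} < k - card {z. z < n \<and> poly P (real z) = 0}"
      using P1(5) True by (rule diff_less_mono2)
    moreover have "poly P1 (real x) \<ge> 0" if "x \<le> n" for x
      using P1(2) that by simp
    ultimately obtain P' where "degree P' \<le> k" "\<forall>x\<le>n. poly P' (real x) \<ge> 0"
      "poly P' (real n) = poly P1 (real n)"
      "(\<Sum>x\<le>n. w x * poly P' (real x)) \<le> (\<Sum>x\<le>n. w x * poly P1 (real x))"
      "k \<le> card {z. z < n \<and> poly P' (real z) = 0}"
      using less.hyps[of P1] P1(1) by blast
    then show ?thesis using P1(3,4) by (intro exI[of _ P']) (auto intro: order_trans)
  next
    case False
    then show ?thesis using less.prems by (intro exI[of _ P]) auto
  qed
qed

text \<open>Just below the largest zero $m$ the product would be negative unless $m - 1$ is a zero as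
  well. Removing the pair $m - 1, m$ leaves a product that is still nonnegative at all integers,
  since $(x - m + 1)(x - m) > 0$ below $m - 1$ and the other zeros are smaller. As the number of
  zeros is even, none is left over.\<close>
lemma even_nonneg_zeros_paired:
  fixes Z :: "nat set"
  assumes "finite Z" "even (card Z)" and "\<And>x::nat. (\<Prod>z\<in>Z. real x - real z) \<ge> 0"
  shows "\<exists>I. I \<subseteq> Z \<and> card Z = 2 * card I \<and>
    (\<forall>y::real. (\<Prod>z\<in>Z. y - real z) = (\<Prod>i\<in>I. (y - real i) * (y - 1 - real i)))"
  using assms
proof (induction "card Z" arbitrary: Z rule: less_induct)
  case less
  show ?case
  proof (cases "Z = {}")
    case True
    then show ?thesis by (intro exI[of _ "{}"]) simp
  next
    case False
    define m where "m = Max Z"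
    have m: "m \<in> Z" "\<And>z. z \<in> Z \<Longrightarrow> z \<le> m"
      using False less.prems(1) by (simp_all add: m_def)
    define Y where "Y = Z - {m}"
    have Z: "Z = insert m Y" "m \<notin> Y" "finite Y" using m less.prems(1) by (auto simp: Y_def)
    have lt: "z < m" if "z \<in> Y" for z using m(2)[of z] that by (auto simp: Y_def less_le)
    have oddY: "odd (card Y)" using less.prems(2) Z by simp
    then have "Y \<noteq> {}" by auto
    then have "m > 0" using lt by (metis all_not_in_conv gr_zeroI not_less_zero)
    have mem: "m - 1 \<in> Y"
    proof (rule ccontr)
      assume "m - 1 \<notin> Y"
      then have "(\<Prod>z\<in>Y. real (m - 1) - real z) > 0"
        using lt by (intro prod_pos) (metis Suc_diff_1 \<open>m > 0\<close> diff_gt_0_iff_gt less_SucE of_nat_less_iff)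
      moreover have "(\<Prod>z\<in>Z. real (m - 1) - real z) = (real (m - 1) - real m) * (\<Prod>z\<in>Y. real (m - 1) - real z)"
        using Z by simp
      moreover have "real (m - 1) - real m < 0" using \<open>m > 0\<close> by simp
      ultimately have "(\<Prod>z\<in>Z. real (m - 1) - real z) < 0" by (simp add: mult_neg_pos)
      then show False using less.prems(3)[of "m - 1"] by simp
    qed
    define X where "X = Y - {m - 1}"
    have Y: "Y = insert (m - 1) X" "m - 1 \<notin> X" "finite X" using mem Z by (auto simp: X_def)
    have prodZ: "(\<Prod>z\<in>Z. y - real z) = ((y - real (m - 1)) * (y - 1 - real (m - 1))) * (\<Prod>z\<in>X. y - real z)" for y
      using Z Y \<open>m > 0\<close> by (simp add: of_nat_diff algebra_simps)
    have ltX: "z < m - 1" if "z \<in> X" for z using lt[of z] that Y by (cases "z = m - 1") auto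
    have "(\<Prod>z\<in>X. real x - real z) \<ge> 0" for x :: nat
    proof (cases "x < m - 1")
      case True
      have "(real x - real (m - 1)) * (real x - 1 - real (m - 1)) > 0"
        using True by (intro mult_neg_neg) auto
      then show ?thesis using less.prems(3)[of x] unfolding prodZ by (simp add: zero_le_mult_iff)
    next
      case False
      then show ?thesis using ltX by (intro prod_nonneg) (auto simp: not_less intro: less_imp_le less_le_trans)
    qed
    moreover have "card Z = card X + 2" using Z Y by simp
    ultimately obtain I where I: "I \<subseteq> X" "card X = 2 * card I"
      "\<forall>y::real. (\<Prod>z\<in>X. y - real z) = (\<Prod>i\<in>I. (y - real i) * (y - 1 - real i))"
      using less.hyps[of X] Y less.prems(2) by auto
    have fI: "finite I" "m - 1 \<notin> I" using I Y by (auto intro: finite_subset)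
    show ?thesis
      using I Z Y fI prodZ by (intro exI[of _ "insert (m - 1) I"]) auto
  qed
qed

section \<open>Measures with prescribed moments\<close>

text \<open>The first-order condition at an endpoint minimum of a convex quadratic function.\<close>
lemma nonneg_first_order:
  fixes a c :: real
  assumes "c \<ge> 0" and "\<And>\<tau>. 0 < \<tau> \<Longrightarrow> \<tau> \<le> 1 \<Longrightarrow> 2 * \<tau> * a + \<tau>\<^sup>2 * c \<ge> 0"
  shows "a \<ge> 0"
proof (rule ccontr)
  assume "\<not> a \<ge> 0"
  define \<tau> where "\<tau> = min 1 (- a / (c + 1))"
  have \<tau>: "0 < \<tau>" "\<tau> \<le> 1" using \<open>\<not> a \<ge> 0\<close> assms(1) by (auto simp: \<tau>_def intro!: divide_pos_pos divide_neg_pos)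
  have "\<tau> * c \<le> \<tau> * (c + 1)" using \<tau> by simp
  also have "\<dots> \<le> - a / (c + 1) * (c + 1)"
    using assms(1) by (intro mult_right_mono) (auto simp: \<tau>_def)
  also have "\<dots> = - a" using assms(1) by simp
  finally have "2 * a + \<tau> * c < 0" using \<open>\<not> a \<ge> 0\<close> by simp
  then have "\<tau> * (2 * a + \<tau> * c) < 0" using \<tau> by (simp add: mult_pos_neg)
  moreover have "\<tau> * (2 * a + \<tau> * c) = 2 * \<tau> * a + \<tau>\<^sup>2 * c"
    by (simp add: power2_eq_square algebra_simps)
  ultimately show False using assms(2)[OF \<tau>] by simp
qed

text \<open>Farkas' lemma for measures of mass $s$ on $\{0, \dots, n\}$ with prescribed moments $b$. Among
  these measures, which form a compact set, take one whose moment vector is closest to $b$, and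
  let $r$ be the residual. Moving mass towards a single point does not decrease the distance; this
  says that the combination of the moment functions with coefficients $r$ is bounded below by a
  constant, and the dual hypothesis for it forces $r = 0$.\<close>
lemma finite_moment_problem_solvable:
  fixes A :: "'j \<Rightarrow> nat \<Rightarrow> real" and b :: "'j \<Rightarrow> real"
  assumes "finite J" "s > 0"
    and dual: "\<And>r t. (\<And>x. x \<le> n \<Longrightarrow> (\<Sum>j\<in>J. r j * A j x) \<ge> t) \<Longrightarrow> (\<Sum>j\<in>J. r j * b j) \<ge> t * s"
  shows "\<exists>\<mu>. (\<forall>x. \<mu> x \<ge> 0) \<and> (\<Sum>x\<le>n. \<mu> x) = s \<and> (\<forall>j\<in>J. (\<Sum>x\<le>n. \<mu> x * A j x) = b j)"
proof -
  define B where "B = (UNIV :: nat set) \<rightarrow>\<^sub>E {0..s}"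
  define K where "K = B \<inter> {f. (\<Sum>x\<le>n. f x) = s}"
  define F where "F f = (\<Sum>j\<in>J. ((\<Sum>x\<le>n. f x * A j x) - b j)\<^sup>2)" for f :: "nat \<Rightarrow> real"
  have "compact B"
    unfolding B_def compactin_euclidean_iff[symmetric] euclidean_product_topology[symmetric]
    by (simp add: compactin_PiE)
  moreover have "closed {f :: nat \<Rightarrow> real. (\<Sum>x\<le>n. f x) = s}"
    by (intro closed_Collect_eq continuous_intros continuous_on_product_coordinates)
  ultimately have "compact K" unfolding K_def by (rule compact_Int_closed)
  have contF: "continuous_on K F"
    unfolding F_def by (intro continuous_intros continuous_on_subset[OF continuous_on_product_coordinates]) auto
  have vertex: "(\<lambda>x. if x = y then s else 0) \<in> K" if "y \<le> n" for y
    using that assms(2) by (auto simp: K_def B_def)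
  then have "K \<noteq> {}" by blast
  then obtain \<mu> where \<mu>: "\<mu> \<in> K" "\<And>f. f \<in> K \<Longrightarrow> F \<mu> \<le> F f"
    using continuous_attains_inf[OF \<open>compact K\<close> _ contF] by blast
  define r where "r j = (\<Sum>x\<le>n. \<mu> x * A j x) - b j" for j
  define T where "T = (\<Sum>j\<in>J. r j * (r j + b j))"
  have "(\<Sum>j\<in>J. r j * A j y) \<ge> T / s" if y: "y \<le> n" for y
  proof -
    define v where "v j = s * A j y - (r j + b j)" for j
    have "2 * \<tau> * (\<Sum>j\<in>J. r j * v j) + \<tau>\<^sup>2 * (\<Sum>j\<in>J. (v j)\<^sup>2) \<ge> 0" if \<tau>: "0 < \<tau>" "\<tau> \<le> 1" for \<tau> :: real
    proof -
      define f where "f x = (1 - \<tau>) * \<mu> x + \<tau> * (if x = y then s else 0)" for x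
      have "f x \<ge> 0" "f x \<le> s" for x
      proof -
        have "0 \<le> \<mu> x" "\<mu> x \<le> s" using \<mu>(1) by (auto simp: K_def B_def)
        then show "f x \<ge> 0" using \<tau> assms(2) by (simp add: f_def)
        have "f x \<le> (1 - \<tau>) * s + \<tau> * s"
          unfolding f_def using \<open>\<mu> x \<le> s\<close> \<tau> assms(2) by (intro add_mono mult_left_mono) auto
        then show "f x \<le> s" by (simp add: algebra_simps)
      qed
      moreover have "(\<Sum>x\<le>n. f x) = s"
      proof -
        have "(\<Sum>x\<le>n. f x) = (1 - \<tau>) * (\<Sum>x\<le>n. \<mu> x) + \<tau> * (\<Sum>x\<le>n. if x = y then s else 0)"
          by (simp only: f_def sum.distrib sum_distrib_left)
        also have "\<dots> = s" using \<mu>(1) y by (simp add: K_def algebra_simps)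
        finally show ?thesis .
      qed
      ultimately have "f \<in> K" by (auto simp: K_def B_def)
      have res: "(\<Sum>x\<le>n. f x * A j x) - b j = r j + \<tau> * v j" for j
      proof -
        have "(\<Sum>x\<le>n. f x * A j x) =
            (\<Sum>x\<le>n. (1 - \<tau>) * (\<mu> x * A j x) + \<tau> * (if x = y then s * A j x else 0))"
          by (rule sum.cong) (auto simp: f_def algebra_simps)
        also have "\<dots> = (1 - \<tau>) * (r j + b j) + \<tau> * (s * A j y)"
          using y by (simp add: sum.distrib r_def flip: sum_distrib_left)
        finally show ?thesis by (simp add: v_def algebra_simps)
      qed
      have "F f = (\<Sum>j\<in>J. (r j + \<tau> * v j)\<^sup>2)" unfolding F_def res ..
      also have "\<dots> = F \<mu> + (2 * \<tau> * (\<Sum>j\<in>J. r j * v j) + \<tau>\<^sup>2 * (\<Sum>j\<in>J. (v j)\<^sup>2))"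
        by (simp add: F_def r_def[symmetric] power2_sum power_mult_distrib sum.distrib sum_distrib_left mult_ac)
      finally show ?thesis using \<mu>(2)[OF \<open>f \<in> K\<close>] by simp
    qed
    moreover have "(\<Sum>j\<in>J. (v j)\<^sup>2) \<ge> 0" by (rule sum_nonneg) simp
    ultimately have "(\<Sum>j\<in>J. r j * v j) \<ge> 0" by (rule nonneg_first_order[rotated])
    then have "T \<le> s * (\<Sum>j\<in>J. r j * A j y)"
      by (simp add: v_def T_def right_diff_distrib sum_subtractf sum_distrib_left mult_ac)
    then show ?thesis using assms(2) by (simp add: divide_le_eq mult.commute)
  qed
  then have "T / s * s \<le> (\<Sum>j\<in>J. r j * b j)" by (rule dual)
  then have "T \<le> (\<Sum>j\<in>J. r j * b j)" using assms(2) by simp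
  then have "(\<Sum>j\<in>J. r j * r j) \<le> 0"
    by (simp add: T_def distrib_left sum.distrib)
  then have "\<forall>j\<in>J. r j = 0"
    using assms(1) by (metis (mono_tags, lifting) antisym mult_eq_0_iff sum_nonneg sum_nonneg_eq_0_iff zero_le_square)
  then show ?thesis
    using \<mu>(1) by (intro exI[of _ \<mu>]) (auto simp: K_def B_def r_def)
qed

section \<open>Binomial moments of the number of ones\<close>

lemma card_subsets_between:
  assumes "finite U" "S \<subseteq> U" "card S \<le> m"
  shows "card {T. S \<subseteq> T \<and> T \<subseteq> U \<and> card T = m} = (card U - card S) choose (m - card S)"
proof -
  have fS: "finite S" using assms finite_subset by blast
  have "bij_betw (\<lambda>R. S \<union> R) {R. R \<subseteq> U - S \<and> card R = m - card S} {T. S \<subseteq> T \<and> T \<subseteq> U \<and> card T = m}"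
  proof (rule bij_betwI[where g = "\<lambda>T. T - S"])
    show "(\<lambda>R. S \<union> R) \<in> {R. R \<subseteq> U - S \<and> card R = m - card S} \<rightarrow> {T. S \<subseteq> T \<and> T \<subseteq> U \<and> card T = m}"
    proof (rule Pi_I)
      fix R assume R: "R \<in> {R. R \<subseteq> U - S \<and> card R = m - card S}"
      then have "finite R" using assms(1) by (auto intro: finite_subset)
      then have "card (S \<union> R) = card S + card R"
        using R fS by (intro card_Un_disjoint) auto
      then show "S \<union> R \<in> {T. S \<subseteq> T \<and> T \<subseteq> U \<and> card T = m}" using R assms by auto
    qed
    show "(\<lambda>T. T - S) \<in> {T. S \<subseteq> T \<and> T \<subseteq> U \<and> card T = m} \<rightarrow> {R. R \<subseteq> U - S \<and> card R = m - card S}"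
      using fS by (auto simp: card_Diff_subset)
  qed auto
  then have "card {T. S \<subseteq> T \<and> T \<subseteq> U \<and> card T = m} = card {R. R \<subseteq> U - S \<and> card R = m - card S}"
    by (simp add: bij_betw_same_card)
  also have "\<dots> = (card (U - S) choose (m - card S))"
    using assms(1) by (simp add: n_subsets)
  finally show ?thesis using assms fS by (simp add: card_Diff_subset)
qed

definition ones :: "nat \<Rightarrow> (nat \<Rightarrow> nat) \<Rightarrow> nat" where
  "ones n x = card {i\<in>{1..n}. x i = 1}"

lemma ones_le: "ones n x \<le> n"
  unfolding ones_def by (rule order_trans[OF card_mono[of "{1..n}"]]) auto

text \<open>The binomial coefficient counts the sets of $s$ coordinates on which $x$ is constantly $1$;
  each such set contributes its probability $p^s$.\<close>
lemma kwise_binomial_moment: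
  assumes Q: "Q \<in> kwise_indep_dists n k p" and "s \<le> k"
  shows "(\<Sum>x\<in>bit_vectors n. pmf Q x * real (ones n x choose s)) = real (n choose s) * p ^ s"
proof -
  define F where "F = {S. S \<subseteq> {1..n} \<and> card S = s}"
  have finF: "finite F" unfolding F_def by simp
  have V: "set_pmf Q \<subseteq> bit_vectors n" using Q by (auto simp: kwise_indep_dists_def)
  have count: "real (ones n x choose s) = (\<Sum>S\<in>F. of_bool (\<forall>i\<in>S. x i = 1))" for x :: "nat \<Rightarrow> nat"
  proof -
    have "ones n x choose s = card {S. S \<subseteq> {i\<in>{1..n}. x i = 1} \<and> card S = s}"
      unfolding ones_def by (simp add: n_subsets)
    also have "{S. S \<subseteq> {i\<in>{1..n}. x i = 1} \<and> card S = s} = F \<inter> {S. \<forall>i\<in>S. x i = 1}"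
      by (auto simp: F_def)
    finally show ?thesis using finF by simp
  qed
  have "(\<Sum>x\<in>bit_vectors n. pmf Q x * real (ones n x choose s)) =
      (\<Sum>S\<in>F. \<Sum>x\<in>bit_vectors n. pmf Q x * of_bool (\<forall>i\<in>S. x i = 1))"
    unfolding count sum_distrib_left by (rule sum.swap)
  also have "\<dots> = (\<Sum>S\<in>F. p ^ s)"
  proof (rule sum.cong[OF refl])
    fix S assume S: "S \<in> F"
    have "(\<Sum>x\<in>bit_vectors n. pmf Q x * of_bool (\<forall>i\<in>S. x i = 1)) =
        (\<Sum>x\<in>bit_vectors n \<inter> {x. \<forall>i\<in>S. x i = 1}. pmf Q x)"
      by (rule sum.mono_neutral_cong_right) (auto simp: finite_bit_vectors)
    also have "\<dots> = measure_pmf.prob Q {x. \<forall>i\<in>S. x i = 1}"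
      by (simp add: prob_bit_vectors[OF V])
    also have "\<dots> = p ^ s" using Q S assms(2) by (auto simp: kwise_indep_dists_def F_def)
    finally show "(\<Sum>x\<in>bit_vectors n. pmf Q x * of_bool (\<forall>i\<in>S. x i = 1)) = p ^ s" .
  qed
  also have "\<dots> = real (n choose s) * p ^ s" by (simp add: F_def n_subsets)
  finally show ?thesis .
qed

text \<open>Draw the number of ones from $\nu$ and then their positions uniformly. A set of $s$
  coordinates lies in a uniform random set of size $m$ with probability
  $\binom{m}{s} / \binom{n}{s}$, so the binomial moments of $\nu$ decide $k$-wise
  independence.\<close>
lemma exchangeable_kwise_dist:
  fixes \<nu> :: "nat \<Rightarrow> real"
  assumes nonneg: "\<And>x. \<nu> x \<ge> 0" and "k \<le> n"
    and moment: "\<And>s. s \<le> k \<Longrightarrow> (\<Sum>x\<le>n. \<nu> x * real (x choose s)) = real (n choose s) * p ^ s"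
  shows "\<exists>Q\<in>kwise_indep_dists n k p. measure_pmf.prob Q {x. \<forall>i\<in>{1..n}. x i = 1} = \<nu> n"
proof -
  let ?U = "{1..n}"
  define f where "f T = (if T \<subseteq> ?U then \<nu> (card T) / real (n choose card T) else 0)" for T
  have f_nonneg: "f T \<ge> 0" for T using nonneg by (simp add: f_def)
  have above: "(\<Sum>T\<in>Pow ?U \<inter> {T. S \<subseteq> T}. f T) = (\<Sum>m\<le>n. \<nu> m * real (m choose card S)) / real (n choose card S)"
    if S: "S \<subseteq> ?U" for S
  proof -
    let ?s = "card S"
    have sn: "?s \<le> n" using card_mono[OF _ S] by simp
    have "(\<Sum>T\<in>Pow ?U \<inter> {T. S \<subseteq> T}. f T) =
        (\<Sum>m\<le>n. \<Sum>T\<in>{T \<in> Pow ?U \<inter> {T. S \<subseteq> T}. card T = m}. f T)"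
      by (rule sum.group[symmetric]) (auto dest: card_mono[rotated])
    also have "\<dots> = (\<Sum>m\<le>n. \<nu> m * real (m choose ?s) / real (n choose ?s))"
    proof (rule sum.cong[OF refl])
      fix m assume m: "m \<in> {..n}"
      have set_eq: "{T \<in> Pow ?U \<inter> {T. S \<subseteq> T}. card T = m} = {T. S \<subseteq> T \<and> T \<subseteq> ?U \<and> card T = m}"
        by auto
      have "(\<Sum>T\<in>{T \<in> Pow ?U \<inter> {T. S \<subseteq> T}. card T = m}. f T) =
          (\<Sum>T\<in>{T. S \<subseteq> T \<and> T \<subseteq> ?U \<and> card T = m}. \<nu> m / real (n choose m))"
        unfolding set_eq by (rule sum.cong) (auto simp: f_def)
      also have "\<dots> = real (card {T. S \<subseteq> T \<and> T \<subseteq> ?U \<and> card T = m}) * (\<nu> m / real (n choose m))"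
        by simp
      also have "\<dots> = \<nu> m * real (m choose ?s) / real (n choose ?s)"
      proof (cases "?s \<le> m")
        case True
        have "real (n choose m) * real (m choose ?s) = real (n choose ?s) * real ((n - ?s) choose (m - ?s))"
          using choose_mult[OF True, of n] m by (metis atMost_iff of_nat_mult)
        moreover have "real (n choose m) \<noteq> 0" "real (n choose ?s) \<noteq> 0" using m sn by auto
        ultimately show ?thesis
          using True S by (simp add: card_subsets_between field_simps)
      next
        case False
        moreover have "?s \<le> card T" if "S \<subseteq> T" "T \<subseteq> ?U" for T
          using that by (intro card_mono) (auto intro: finite_subset)
        ultimately have "{T. S \<subseteq> T \<and> T \<subseteq> ?U \<and> card T = m} = {}" by blast
        then have "card {T. S \<subseteq> T \<and> T \<subseteq> ?U \<and> card T = m} = 0" by (simp only: card.empty)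
        then show ?thesis using False by (simp add: binomial_eq_0 del: card_eq_0_iff)
      qed
      finally show "(\<Sum>T\<in>{T \<in> Pow ?U \<inter> {T. S \<subseteq> T}. card T = m}. f T) =
          \<nu> m * real (m choose ?s) / real (n choose ?s)" .
    qed
    finally show ?thesis by (simp add: sum_divide_distrib)
  qed
  have total: "(\<Sum>T\<in>Pow ?U. f T) = 1"
    using above[of "{}"] moment[of 0] by simp
  have "(\<integral>\<^sup>+T. ennreal (f T) \<partial>count_space UNIV) = (\<Sum>T\<in>Pow ?U. ennreal (f T))"
    by (intro nn_integral_count_space') (auto simp: f_def split: if_splits)
  also have "\<dots> = 1" using total f_nonneg by (simp add: sum_ennreal)
  finally have one: "(\<integral>\<^sup>+T. ennreal (f T) \<partial>count_space UNIV) = 1" .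
  define R where "R = embed_pmf f"
  have R: "pmf R = f" unfolding R_def using pmf_embed_pmf[of f] f_nonneg one by auto
  have supp: "set_pmf R \<subseteq> Pow ?U" using R by (auto simp: set_pmf_eq f_def split: if_splits)
  define ind where "ind T = restrict (\<lambda>i. if i \<in> T then 1 else (0::nat)) ?U" for T
  define Q where "Q = map_pmf ind R"
  have prob: "measure_pmf.prob Q {x. \<forall>i\<in>S. x i = 1} =
      (\<Sum>m\<le>n. \<nu> m * real (m choose card S)) / real (n choose card S)" if S: "S \<subseteq> ?U" for S
  proof -
    have "ind -` {x. \<forall>i\<in>S. x i = 1} = {T. S \<subseteq> T}"
      using S by (auto simp: ind_def subset_iff split: if_splits)
    then have "measure_pmf.prob Q {x. \<forall>i\<in>S. x i = 1} = measure_pmf.prob R {T. S \<subseteq> T}"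
      by (simp add: Q_def)
    also have "\<dots> = measure_pmf.prob R (Pow ?U \<inter> {T. S \<subseteq> T})"
      using supp by (intro measure_pmf.finite_measure_eq_AE) (auto simp: AE_measure_pmf_iff)
    also have "\<dots> = (\<Sum>T\<in>Pow ?U \<inter> {T. S \<subseteq> T}. f T)"
      by (simp add: measure_measure_pmf_finite R)
    finally show ?thesis using above[OF S] by simp
  qed
  have "Q \<in> kwise_indep_dists n k p"
  proof -
    have "set_pmf Q \<subseteq> bit_vectors n" by (auto simp: Q_def ind_def bit_vectors_def split: if_splits)
    moreover have "measure_pmf.prob Q {x. \<forall>i\<in>S. x i = 1} = p ^ card S" if "S \<subseteq> ?U" "card S \<le> k" for S
      using prob[OF that(1)] moment[OF that(2)] that(2) assms(2) by simp
    ultimately show ?thesis by (simp add: kwise_indep_dists_def)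
  qed
  moreover have "measure_pmf.prob Q {x. \<forall>i\<in>?U. x i = 1} = \<nu> n"
  proof -
    have "(\<Sum>m\<le>n. \<nu> m * real (m choose n)) = (\<Sum>m\<in>{n}. \<nu> m * real (m choose n))"
      by (rule sum.mono_neutral_right) auto
    then show ?thesis using prob[of ?U] by simp
  qed
  ultimately show ?thesis by blast
qed

section \<open>Bounds in terms of binomial coefficients\<close>

context binomial_law
begin

lemma poly_eq_krawtchouk_sum:
  assumes "degree P \<le> d"
  obtains c where "\<And>x. x \<le> n \<Longrightarrow> poly P (real x) = krawtchouk_sum c d x"
proof -
  obtain c where "P = (\<Sum>j\<le>d. smult (c j) (krawtchouk_poly j))"
    using poly_in_span_of_degree_basis[of d krawtchouk_poly P] assms
      degree_krawtchouk_poly krawtchouk_poly_nonzero by blast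
  then have "poly P (real x) = krawtchouk_sum c d x" if "x \<le> n" for x
    using that by (simp add: poly_sum krawtchouk_sum_def poly_krawtchouk_poly)
  then show ?thesis by (rule that)
qed

lemma christoffel_ge_1: "christoffel d \<ge> 1" if "d \<le> n"
proof -
  have "sq_norm 0 / p ^ (2 * 0) \<le> christoffel d"
    unfolding christoffel_def
    by (rule member_le_sum[of 0 "{..d}" "\<lambda>j. sq_norm j / p ^ (2 * j)"])
       (use that p_pos in \<open>auto intro!: divide_nonneg_pos less_imp_le[OF sq_norm_pos]\<close>)
  then show ?thesis by (simp add: sq_norm_def)
qed

lemma mean_mono: "(\<And>x. x \<le> n \<Longrightarrow> f x \<le> g x) \<Longrightarrow> mean f \<le> mean g"
  unfolding mean_def by (intro sum_mono mult_left_mono) (auto intro: less_imp_le[OF weight_pos])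

text \<open>Here $W(x) = g(x) g(x-1)$ where $g$ is the product of $x - i$ over $i \in I$. On the one
  hand $W(n) \le g(n)^2$. On the other hand $W = g^2 - g \nabla g$, and the smallness
  assumption gives $\|\nabla g\| \le \|g\| / 2$, so that the mean of $W$ is at least
  $\|g\|^2 / 2$.\<close>
lemma paired_product_mean:
  fixes I :: "nat set"
  assumes small: "16 * real d \<le> real (n - d) * p * (1 - p)" and d: "d \<le> n"
    and I: "card I = d" "I \<subseteq> {..<n}"
  defines "W \<equiv> \<lambda>y::real. \<Prod>i\<in>I. (y - real i) * (y - 1 - real i)"
  shows "W (real n) \<le> 2 * christoffel d * mean (\<lambda>x. W (real x))"
proof -
  define G where "G = (\<Prod>i\<in>I. [:- real i, 1:])"
  define g where "g x = poly G (real x)" for x :: nat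
  have polyG: "poly G y = (\<Prod>i\<in>I. y - real i)" for y by (simp add: G_def poly_prod)
  have W: "W y = poly G y * poly G (y - 1)" for y
    by (simp add: W_def polyG prod.distrib)
  have "degree G \<le> d"
    using I(1) by (simp add: G_def degree_prod_eq_sum_degree)
  then obtain c where c: "\<And>x. x \<le> n \<Longrightarrow> g x = krawtchouk_sum c d x"
    using poly_eq_krawtchouk_sum unfolding g_def by blast
  let ?h = "krawtchouk_sum c d"
  have "wnorm (back_diff ?h) \<le> 2 * (1 / 4) * wnorm ?h"
    using sq_norm_ratio[of _ d] small d by (intro back_diff_krawtchouk_sum) auto
  then have "wnorm ?h * wnorm (back_diff ?h) \<le> wnorm ?h * (2 * (1 / 4) * wnorm ?h)"
    by (rule mult_left_mono) (rule wnorm_nonneg)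
  then have cross: "mean (\<lambda>x. ?h x * back_diff ?h x) \<le> (wnorm ?h)\<^sup>2 / 2"
    using mean_product_le[of ?h "back_diff ?h"] by (simp add: power2_eq_square)
  \<comment> \<open>At $x = 0$ the truncated difference does not see $g(-1)$, but $g(0) g(-1) \ge g(0)^2$ because
    all zeros of $g$ are nonnegative.\<close>
  have pointwise: "(?h x)\<^sup>2 - ?h x * back_diff ?h x \<le> W (real x)" if x: "x \<le> n" for x
  proof (cases "x = 0")
    case True
    have "(?h 0)\<^sup>2 = (\<Prod>i\<in>I. - real i) * (\<Prod>i\<in>I. - real i)"
      using c[of 0] by (simp add: g_def polyG power2_eq_square)
    also have "\<dots> = (\<Prod>i\<in>I. real i * real i)"
      by (simp flip: prod.distrib)
    also have "\<dots> \<le> (\<Prod>i\<in>I. real i * (1 + real i))"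
      by (intro prod_mono) (simp add: mult_left_mono)
    also have "\<dots> = W 0"
      unfolding W_def by (intro prod.cong refl) (simp add: algebra_simps)
    finally show ?thesis using True by (simp add: back_diff_def)
  next
    case False
    then have "(?h x)\<^sup>2 - ?h x * back_diff ?h x = g x * g (x - 1)"
      using c[of x] c[of "x - 1"] x by (simp add: back_diff_def power2_eq_square algebra_simps)
    also have "\<dots> = W (real x)" using False by (simp add: W g_def of_nat_diff)
    finally show ?thesis by simp
  qed
  have "(wnorm ?h)\<^sup>2 / 2 \<le> (wnorm ?h)\<^sup>2 - mean (\<lambda>x. ?h x * back_diff ?h x)"
    using cross by simp
  also have "\<dots> = mean (\<lambda>x. (?h x)\<^sup>2 - ?h x * back_diff ?h x)"
    by (simp add: wnorm_squared mean_def right_diff_distrib sum_subtractf)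
  also have "\<dots> \<le> mean (\<lambda>x. W (real x))" by (rule mean_mono) (rule pointwise)
  finally have lower: "(wnorm ?h)\<^sup>2 \<le> 2 * mean (\<lambda>x. W (real x))" by simp
  have "W (real n) \<le> (\<Prod>i\<in>I. (real n - real i)\<^sup>2)"
    unfolding W_def
  proof (rule prod_mono)
    fix i assume "i \<in> I"
    then have "real i + 1 \<le> real n" using I(2) by (auto simp: subset_iff)
    then show "0 \<le> (real n - real i) * (real n - 1 - real i) \<and>
        (real n - real i) * (real n - 1 - real i) \<le> (real n - real i)\<^sup>2"
      unfolding power2_eq_square by (auto intro!: mult_nonneg_nonneg mult_left_mono)
  qed
  also have "\<dots> = (?h n)\<^sup>2" 
    using c[of n, symmetric] by (simp add: g_def polyG flip: prod_power_distrib)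
  also have "\<dots> \<le> christoffel d * (wnorm ?h)\<^sup>2" using d by (rule value_at_n_bound)
  also have "\<dots> \<le> christoffel d * (2 * mean (\<lambda>x. W (real x)))"
    using lower christoffel_ge_1[OF d] by (intro mult_left_mono) auto
  finally show ?thesis by simp
qed

text \<open>The dual form of the lower bound. After the descent $P$ has the $2d$ zeros $Z$ below $n$,
  which determine it up to a nonnegative factor $c$; pairing the zeros brings it into the form
  $g(x) g(x-1)$.\<close>
lemma value_at_n_le_mean:
  assumes small: "16 * real d \<le> real (n - d) * p * (1 - p)" and dn: "2 * d < n"
    and deg: "degree P \<le> 2 * d" and nonneg: "\<And>x. x \<le> n \<Longrightarrow> poly P (real x) \<ge> 0"
  shows "poly P (real n) \<le> 2 * christoffel d * mean (\<lambda>x. poly P (real x))"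
proof -
  have d: "d \<le> n" using dn by simp
  obtain P' where P': "degree P' \<le> 2 * d" "\<forall>x\<le>n. poly P' (real x) \<ge> 0" "poly P' (real n) = poly P (real n)"
    "mean (\<lambda>x. poly P' (real x)) \<le> mean (\<lambda>x. poly P (real x))"
    "2 * d \<le> card {z. z < n \<and> poly P' (real z) = 0}"
    using descend_to_k_zeros[where w = weight, OF weight_pos dn deg nonneg] unfolding mean_def by blast
  obtain Z where Z: "Z \<subseteq> {z. z < n \<and> poly P' (real z) = 0}" "card Z = 2 * d" "finite Z"
    using obtain_subset_with_card_n[OF P'(5)] by blast
  have Zn: "z < n" if "z \<in> Z" for z using that Z(1) by auto
  define W where "W y = (\<Prod>z\<in>Z. y - real z)" for y :: real
  define Wp where "Wp = (\<Prod>z\<in>Z. [:- real z, 1:])"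
  have polyWp: "poly Wp y = W y" for y by (simp add: Wp_def W_def poly_prod)
  have Wn: "W (real x) > 0" if "x \<ge> n" for x
    unfolding W_def using Zn that by (intro prod_pos) (fastforce dest: less_le_trans)
  define c where "c = poly P' (real n) / W (real n)"
  have "P' = smult c Wp"
  proof (rule poly_eqI_degree[where A = "real ` insert n Z"])
    fix y assume "y \<in> real ` insert n Z"
    then consider "y = real n" | z where "z \<in> Z" "y = real z" by auto
    then show "poly P' y = poly (smult c Wp) y"
    proof cases
      case 1 then show ?thesis using Wn[of n] by (simp add: polyWp c_def)
    next
      case 2
      then have "W y = 0" using Z(3) by (auto simp: W_def)
      then show ?thesis using 2 Z(1) by (auto simp: polyWp)
    qed
  next
    have card: "card (real ` insert n Z) = 2 * d + 1"
    proof -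
      have "n \<notin> Z" using Zn by blast
      then show ?thesis using Z by (subst card_image) auto
    qed
    show "degree P' < card (real ` insert n Z)" using P'(1) card by simp
    have "degree Wp = 2 * d" using Z(2) by (simp add: Wp_def degree_prod_eq_sum_degree)
    then have "degree (smult c Wp) \<le> 2 * d" by (metis degree_smult_le)
    then show "degree (smult c Wp) < card (real ` insert n Z)" using card by simp
  qed
  then have P'_eq: "poly P' y = c * W y" for y by (simp add: polyWp)
  have c0: "c \<ge> 0" unfolding c_def using P'(2) Wn[of n] by simp
  have "poly P' (real n) \<le> 2 * christoffel d * mean (\<lambda>x. poly P' (real x))"
  proof (cases "c = 0")
    case True then show ?thesis by (simp add: P'_eq mean_def)
  next
    case False
    have "W (real x) \<ge> 0" for x
    proof (cases "x \<le> n")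
      case True
      then have "c * W (real x) \<ge> 0" using P'(2) P'_eq by metis
      then show ?thesis using False c0 by (simp add: zero_le_mult_iff)
    next
      case False then show ?thesis using Wn[of x] by simp
    qed
    then obtain I where I: "I \<subseteq> Z" "card Z = 2 * card I"
      "\<forall>y::real. (\<Prod>z\<in>Z. y - real z) = (\<Prod>i\<in>I. (y - real i) * (y - 1 - real i))"
      using even_nonneg_zeros_paired[of Z] Z unfolding W_def by auto
    have W_eq: "W y = (\<Prod>i\<in>I. (y - real i) * (y - 1 - real i))" for y
      unfolding W_def using I(3) by blast
    have "card I = d" "I \<subseteq> {..<n}" using I Z(2) Zn by auto
    then have "W (real n) \<le> 2 * christoffel d * mean (\<lambda>x. W (real x))"
      unfolding W_eq by (rule paired_product_mean[OF small d])
    then have "c * W (real n) \<le> c * (2 * christoffel d * mean (\<lambda>x. W (real x)))"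
      using c0 by (rule mult_left_mono)
    also have "\<dots> = 2 * christoffel d * mean (\<lambda>x. c * W (real x))"
      by (simp add: mean_def sum_distrib_left mult_ac)
    finally show ?thesis by (simp add: P'_eq)
  qed
  also have "\<dots> \<le> 2 * christoffel d * mean (\<lambda>x. poly P (real x))"
    using P'(4) christoffel_ge_1[OF d] by (intro mult_left_mono) auto
  finally show ?thesis by (simp add: P'(3))
qed

lemma mean_binomial:
  assumes "j \<le> n"
  shows "mean (\<lambda>x. real (x choose j)) = real (n choose j) * p ^ j"
proof -
  have "(\<Sum>j\<le>n. mean (\<lambda>x. real (x choose j)) * t ^ j) = (\<Sum>j\<le>n. (real (n choose j) * p ^ j) * t ^ j)"
    for t
  proof -
    have bin: "(\<Sum>j\<le>n. real (x choose j) * t ^ j) = (t + 1) ^ x" if "x \<le> n" for x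
    proof -
      have "(t + 1) ^ x = (\<Sum>j\<le>x. real (x choose j) * t ^ j)" by (simp add: binomial_ring)
      also have "\<dots> = (\<Sum>j\<le>n. real (x choose j) * t ^ j)"
        using that by (intro sum.mono_neutral_left) auto
      finally show ?thesis by simp
    qed
    have "(\<Sum>j\<le>n. mean (\<lambda>x. real (x choose j)) * t ^ j) =
        (\<Sum>j\<le>n. \<Sum>x\<le>n. weight x * (real (x choose j) * t ^ j))"
      unfolding mean_def sum_distrib_right by (simp add: mult_ac)
    also have "\<dots> = (\<Sum>x\<le>n. \<Sum>j\<le>n. weight x * (real (x choose j) * t ^ j))"
      by (rule sum.swap)
    also have "\<dots> = (\<Sum>x\<le>n. weight x * (t + 1) ^ x)"
      by (rule sum.cong) (simp_all add: bin flip: sum_distrib_left)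
    also have "\<dots> = (\<Sum>x\<le>n. real (n choose x) * (p * (t + 1)) ^ x * (1 - p) ^ (n - x))"
      by (simp add: weight_def power_mult_distrib mult_ac)
    also have "\<dots> = (p * (t + 1) + (1 - p)) ^ n" by (simp add: binomial_ring)
    also have "\<dots> = (p * t + 1) ^ n" by (simp add: algebra_simps)
    also have "\<dots> = (\<Sum>j\<le>n. (real (n choose j) * p ^ j) * t ^ j)"
      by (subst binomial_ring) (simp add: power_mult_distrib mult_ac)
    finally show ?thesis .
  qed
  then show ?thesis
    using assms polyfun_eq_coeffs[of "\<lambda>j. mean (\<lambda>x. real (x choose j))" n "\<lambda>j. real (n choose j) * p ^ j"]
    by simp
qed

text \<open>Duality is applied to the moments that remain when an atom of mass $l$ at $n$ is taken away
  from the binomial law: the inequality for $P(n)$ is exactly the condition that these are the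
  moments of a positive measure. Putting the atom back gives the number of ones of a $2d$-wise
  independent distribution.\<close>
lemma max_all_ones_ge:
  assumes small: "16 * real d \<le> real (n - d) * p * (1 - p)" and dn: "2 * d < n"
  shows "max_all_ones n (2 * d) p \<ge> 1 / (2 * christoffel d)"
proof -
  define l where "l = 1 / (2 * christoffel d)"
  have chr: "christoffel d \<ge> 1" using dn by (intro christoffel_ge_1) simp
  have l: "0 < l" "l < 1" using chr by (auto simp: l_def field_simps)
  have "\<exists>\<mu>. (\<forall>x. \<mu> x \<ge> 0) \<and> (\<Sum>x\<le>n. \<mu> x) = 1 - l \<and>
      (\<forall>j\<in>{..2 * d}. (\<Sum>x\<le>n. \<mu> x * real (x choose j)) = real (n choose j) * p ^ j - l * real (n choose j))"
  proof (rule finite_moment_problem_solvable)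
    fix r t assume H: "\<And>x. x \<le> n \<Longrightarrow> t \<le> (\<Sum>j\<in>{..2 * d}. r j * real (x choose j))"
    define P where "P = (\<Sum>j\<le>2 * d. smult (r j) (binomial_poly j)) - [:t:]"
    have polyP: "poly P (real x) = (\<Sum>j\<le>2 * d. r j * real (x choose j)) - t" for x
      by (simp add: P_def poly_sum poly_binomial_poly)
    have "degree P \<le> 2 * d" unfolding P_def
      by (intro degree_diff_le degree_sum_le order_trans[OF degree_smult_le])
         (auto simp: degree_binomial_poly)
    moreover have "poly P (real x) \<ge> 0" if "x \<le> n" for x using H[OF that] by (simp add: polyP)
    ultimately have "poly P (real n) \<le> 2 * christoffel d * mean (\<lambda>x. poly P (real x))"
      using value_at_n_le_mean[OF small dn] by blast
    then have le: "l * poly P (real n) \<le> mean (\<lambda>x. poly P (real x))"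
      using chr by (simp add: l_def divide_le_eq mult_ac)
    have one: "mean (\<lambda>x. 1) = 1" using mean_binomial[of 0] by simp
    have "mean (\<lambda>x. poly P (real x)) = (\<Sum>j\<le>2 * d. r j * mean (\<lambda>x. real (x choose j))) - t * mean (\<lambda>x. 1)"
    proof -
      have "mean (\<lambda>x. \<Sum>j\<le>2 * d. r j * real (x choose j)) = (\<Sum>j\<le>2 * d. r j * mean (\<lambda>x. real (x choose j)))"
        unfolding mean_def sum_distrib_left by (subst sum.swap) (simp add: mult_ac)
      then show ?thesis
        by (simp add: polyP mean_def right_diff_distrib sum_subtractf sum_distrib_left mult_ac)
    qed
    also have "\<dots> = (\<Sum>j\<le>2 * d. r j * (real (n choose j) * p ^ j)) - t"
      using dn one by (simp add: mean_binomial)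
    finally have "l * ((\<Sum>j\<le>2 * d. r j * real (n choose j)) - t) \<le> (\<Sum>j\<le>2 * d. r j * (real (n choose j) * p ^ j)) - t"
      using le by (simp add: polyP)
    then show "t * (1 - l) \<le> (\<Sum>j\<in>{..2 * d}. r j * (real (n choose j) * p ^ j - l * real (n choose j)))"
      by (simp add: right_diff_distrib sum_subtractf sum_distrib_left mult_ac)
  qed (use l in auto)
  then obtain \<mu> where \<mu>: "\<And>x. \<mu> x \<ge> 0"
    "\<And>j. j \<le> 2 * d \<Longrightarrow> (\<Sum>x\<le>n. \<mu> x * real (x choose j)) = real (n choose j) * p ^ j - l * real (n choose j)"
    by auto
  define \<nu> where "\<nu> x = \<mu> x + l * of_bool (x = n)" for x
  have "(\<Sum>x\<le>n. \<nu> x * real (x choose s)) = real (n choose s) * p ^ s" if "s \<le> 2 * d" for s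
  proof -
    have "(\<Sum>x\<le>n. \<nu> x * real (x choose s)) =
        (\<Sum>x\<le>n. \<mu> x * real (x choose s)) + (\<Sum>x\<le>n. if x = n then l * real (x choose s) else 0)"
      unfolding sum.distrib[symmetric] by (rule sum.cong) (auto simp: \<nu>_def algebra_simps)
    then show ?thesis using \<mu>(2)[OF that] by simp
  qed
  moreover have "\<nu> x \<ge> 0" for x using \<mu>(1) l by (simp add: \<nu>_def)
  ultimately obtain Q where Q: "Q \<in> kwise_indep_dists n (2 * d) p"
    "measure_pmf.prob Q {x. \<forall>i\<in>{1..n}. x i = 1} = \<nu> n"
    using exchangeable_kwise_dist[of \<nu> "2 * d" n p] dn by auto
  have "l \<le> \<nu> n" using \<mu>(1) by (simp add: \<nu>_def)
  also have "\<dots> \<le> max_all_ones n (2 * d) p"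
    using max_all_ones_attained[OF p_pos p_less_1, of n "2 * d"] Q(1)
    unfolding Q(2)[symmetric] by auto
  finally show ?thesis by (simp add: l_def)
qed

lemma kwise_poly_moment:
  assumes Q: "Q \<in> kwise_indep_dists n k p" and "k \<le> n" "degree P \<le> k"
  shows "(\<Sum>x\<in>bit_vectors n. pmf Q x * poly P (real (ones n x))) = mean (\<lambda>x. poly P (real x))"
proof -
  obtain c where c: "P = (\<Sum>j\<le>k. smult (c j) (binomial_poly j))"
    using poly_in_span_of_degree_basis[of k binomial_poly P] assms(3)
      degree_binomial_poly binomial_poly_nonzero by blast
  have P: "poly P (real x) = (\<Sum>j\<le>k. c j * real (x choose j))" for x
    by (simp add: c poly_sum poly_binomial_poly)
  have "(\<Sum>x\<in>bit_vectors n. pmf Q x * poly P (real (ones n x))) =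
      (\<Sum>j\<le>k. c j * (\<Sum>x\<in>bit_vectors n. pmf Q x * real (ones n x choose j)))"
    unfolding P sum_distrib_left by (subst sum.swap) (simp add: mult_ac)
  also have "\<dots> = (\<Sum>j\<le>k. c j * mean (\<lambda>x. real (x choose j)))"
    using assms(2) by (intro sum.cong refl) (simp add: kwise_binomial_moment[OF Q] mean_binomial)
  also have "\<dots> = mean (\<lambda>x. poly P (real x))"
    unfolding P mean_def sum_distrib_left by (subst sum.swap) (simp add: mult_ac)
  finally show ?thesis .
qed

text \<open>All ones contributes at least its probability times $K_d(n)^2$ to the expectation of $K_d^2$,
  which equals the binomial one because $K_d^2$ has degree $2d$.\<close>
lemma max_all_ones_le:
  assumes "2 * d \<le> n"
  shows "max_all_ones n (2 * d) p \<le> p ^ (2 * d) / sq_norm d"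
proof -
  let ?A = "{x :: nat \<Rightarrow> nat. \<forall>i\<in>{1..n}. x i = 1}"
  obtain Q where Q: "Q \<in> kwise_indep_dists n (2 * d) p"
    "max_all_ones n (2 * d) p = measure_pmf.prob Q ?A"
    using max_all_ones_attained[OF p_pos p_less_1] by blast
  have V: "set_pmf Q \<subseteq> bit_vectors n" using Q by (auto simp: kwise_indep_dists_def)
  have dn: "d \<le> n" using assms by simp
  define P where "P = krawtchouk_poly d * krawtchouk_poly d"
  have polyP: "poly P (real x) = (krawtchouk d x)\<^sup>2" if "x \<le> n" for x
    using that by (simp add: P_def poly_krawtchouk_poly power2_eq_square)
  have degP: "degree P \<le> 2 * d"
    unfolding P_def by (rule order_trans[OF degree_mult_le]) (simp add: degree_krawtchouk_poly)
  have all_ones: "ones n x = n" if "x \<in> ?A" for x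
  proof -
    have "{i \<in> {1..n}. x i = 1} = {1..n}" using that by auto
    then show ?thesis by (simp add: ones_def)
  qed
  have "measure_pmf.prob Q ?A * (krawtchouk d n)\<^sup>2 =
      (\<Sum>x\<in>bit_vectors n \<inter> ?A. pmf Q x * poly P (real (ones n x)))"
    unfolding prob_bit_vectors[OF V] sum_distrib_right
    by (rule sum.cong) (simp_all add: all_ones polyP del: mem_Collect_eq)
  also have "\<dots> \<le> (\<Sum>x\<in>bit_vectors n. pmf Q x * poly P (real (ones n x)))"
    by (rule sum_mono2) (auto simp: finite_bit_vectors polyP[OF ones_le])
  also have "\<dots> = mean (\<lambda>x. poly P (real x))"
    using Q(1) assms degP by (rule kwise_poly_moment)
  also have "\<dots> = mean (\<lambda>x. krawtchouk d x * krawtchouk d x)"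
    unfolding mean_def by (rule sum.cong) (simp_all add: polyP power2_eq_square)
  also have "\<dots> = sq_norm d" using krawtchouk_orthogonal[OF dn dn] by simp
  finally have "sq_norm d * (measure_pmf.prob Q ?A * (sq_norm d / p ^ (2 * d))) \<le> sq_norm d * 1"
    unfolding krawtchouk_at_n_squared[OF dn] by (simp add: mult_ac)
  then have "measure_pmf.prob Q ?A * (sq_norm d / p ^ (2 * d)) \<le> 1"
    using sq_norm_pos[OF dn] by (simp only: mult_le_cancel_left_pos)
  then show ?thesis
    using sq_norm_pos[OF dn] p_pos unfolding Q(2) by (simp add: field_simps)
qed

end

section \<open>Asymptotic form of the bounds\<close>

lemma fact_ge_pow_over_exp: "(real d / exp 1) ^ d \<le> fact d"
proof -
  have "(\<Sum>i\<in>{d}. inverse (fact i) * real d ^ i) \<le> (\<Sum>i. inverse (fact i) * real d ^ i)"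
    by (rule sum_le_suminf[OF summable_exp]) auto
  then have "real d ^ d / fact d \<le> exp (real d)"
    by (simp add: exp_def scaleR_conv_of_real divide_inverse mult.commute)
  also have "exp (real d) = exp 1 ^ d" by (simp flip: exp_of_nat_mult)
  finally show ?thesis by (simp add: power_divide field_simps)
qed

text \<open>The step from $d$ to $d + 1$ needs $e \le (1 + 1/d)^{d + 1/2}$, which is the midpoint bound
  $\ln (d+1) - \ln d \ge 1 / (d + 1/2)$.\<close>
lemma fact_le_sqrt_pow_over_exp:
  assumes "d \<ge> 1"
  shows "fact d \<le> exp 1 * sqrt (real d) * (real d / exp 1) ^ d"
  using assms
proof (induction d rule: nat_induct_at_least)
  case base
  then show ?case by simp
next
  case (Suc d)
  let ?q = "real (Suc d) / real d"
  have d: "real d > 0" using Suc.hyps by simp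
  have "1 = (2 / (real d + real (Suc d))) * (real d + 1 / 2)" by (simp add: field_simps)
  also have "\<dots> \<le> (ln (real (Suc d)) - ln (real d)) * (real d + 1 / 2)"
    using ln_inverse_approx_ge[of "real d" "real (Suc d)"] d by (intro mult_right_mono) auto
  finally have "exp 1 \<le> exp (ln ?q * (real d + 1 / 2))" using d by (simp add: ln_div)
  also have "\<dots> = ?q powr (real d + 1 / 2)" using d by (simp add: powr_def mult.commute)
  also have "\<dots> = ?q ^ d * sqrt ?q"
    using d by (simp add: powr_add powr_realpow powr_half_sqrt)
  finally have e: "exp 1 * (sqrt (real d) * real d ^ d) \<le> sqrt (real (Suc d)) * real (Suc d) ^ d"
    using d by (simp add: power_divide real_sqrt_divide field_simps)
  have "fact (Suc d) = real (Suc d) * fact d" by simp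
  also have "\<dots> \<le> real (Suc d) * (exp 1 * sqrt (real d) * (real d / exp 1) ^ d)"
    using Suc.IH by (rule mult_left_mono) simp
  also have "\<dots> = (exp 1 * (sqrt (real d) * real d ^ d)) * (real (Suc d) / exp 1 ^ d)"
    by (simp add: power_divide)
  also have "\<dots> \<le> (sqrt (real (Suc d)) * real (Suc d) ^ d) * (real (Suc d) / exp 1 ^ d)"
    using e by (rule mult_right_mono) simp
  also have "\<dots> = exp 1 * sqrt (real (Suc d)) * (real (Suc d) / exp 1) ^ Suc d"
    by (simp add: power_divide)
  finally show ?case .
qed

text \<open>The factors $1 - i/n$ with $i < d$ are at least $e^{-2i/n}$ as $i \le n/2$.\<close>
lemma falling_factorial_ge:
  assumes "2 * d \<le> n"
  shows "real n ^ d * exp (- ((real d)\<^sup>2 / real n)) \<le> real (n choose d) * fact d"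
  using assms
proof (induction d)
  case 0
  then show ?case by simp
next
  case (Suc d)
  let ?x = "real d / real n"
  have n: "real n > 0" using Suc.prems by simp
  have x: "0 \<le> ?x" "?x \<le> 1 / 2" using Suc.prems n by (simp_all add: field_simps)
  have "2 * ?x\<^sup>2 \<le> ?x" using mult_right_mono[OF x(2) x(1)] unfolding power2_eq_square by simp
  then have "- (2 * ?x) \<le> ln (1 - ?x)"
    using ln_one_minus_pos_lower_bound[OF x] by simp
  then have "exp (- (2 * ?x)) \<le> exp (ln (1 - ?x))" by (simp only: exp_le_cancel_iff)
  also have "\<dots> = 1 - ?x" by (rule exp_ln) (use x in linarith)
  finally have "real n * exp (- (2 * ?x)) \<le> real n * (1 - ?x)" using n by (intro mult_left_mono) auto
  then have step: "real n * exp (- (2 * ?x)) \<le> real (n - d)"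
    using n Suc.prems by (simp add: right_diff_distrib of_nat_diff)
  have "(real (Suc d))\<^sup>2 / real n = (real d)\<^sup>2 / real n + 2 * ?x + 1 / real n"
    by (simp add: power2_eq_square add_divide_distrib algebra_simps)
  then have "exp (- ((real (Suc d))\<^sup>2 / real n)) \<le> exp (- (2 * ?x)) * exp (- ((real d)\<^sup>2 / real n))"
    using n by (simp flip: exp_add)
  then have "real n ^ Suc d * exp (- ((real (Suc d))\<^sup>2 / real n)) \<le>
      real n ^ Suc d * (exp (- (2 * ?x)) * exp (- ((real d)\<^sup>2 / real n)))"
    by (rule mult_left_mono) simp
  also have "\<dots> = (real n * exp (- (2 * ?x))) * (real n ^ d * exp (- ((real d)\<^sup>2 / real n)))"
    by simp
  also have "\<dots> \<le> real (n - d) * (real (n choose d) * fact d)"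
    using Suc.prems by (intro mult_mono[OF step Suc.IH]) auto
  also have "\<dots> = real ((n - d) * (n choose d)) * fact d" by simp
  also have "(n - d) * (n choose d) = Suc d * (n choose Suc d)"
    by (simp only: binomial_absorb_comp binomial_absorption)
  finally show ?case by (simp add: algebra_simps)
qed

lemma max_all_ones_sandwich:
  fixes n d :: nat and p :: real
  assumes p: "0 < p" "p < 1" and d: "d \<ge> 1" and large: "32 * real d \<le> real n * p * (1 - p)"
  defines "R \<equiv> (p * real d / (exp 1 * (1 - p) * real n)) ^ d"
  shows "R / 4 \<le> max_all_ones n (2 * d) p"
    and "max_all_ones n (2 * d) p \<le> exp 1 * sqrt (real d) * exp ((real d)\<^sup>2 / real n) * R"
proof -
  interpret binomial_law n p using p by unfold_locales
  have pq: "p * (1 - p) > 0" "p * (1 - p) \<le> 1" using p by (auto intro: mult_le_one)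
  have "real n * (p * (1 - p)) \<le> real n * 1" using pq by (intro mult_left_mono) auto
  then have n32: "32 * real d \<le> real n" using large by (simp add: mult.assoc)
  then have dn: "2 * d < n" using d by linarith
  have n: "real n > 0" using dn by simp
  have small: "16 * real d \<le> real (n - d) * p * (1 - p)"
  proof -
    have "real n * (p * (1 - p)) \<le> (2 * real (n - d)) * (p * (1 - p))"
      using dn pq by (intro mult_right_mono) (auto simp: of_nat_diff)
    then show ?thesis using large unfolding mult.assoc by linarith
  qed
  \<comment> \<open>The maximum lies between $T/4$ and $T$; what remains is to compare $T$ with $R$.\<close>
  define T where "T = p ^ (2 * d) / sq_norm d"
  define s where "s = (p / (1 - p)) ^ d"
  have s: "s > 0" using p by (simp add: s_def)
  have C: "real (n choose d) > 0" using dn by simp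
  have T: "T = s / real (n choose d)"
    using p by (simp add: T_def s_def sq_norm_def power_mult_distrib mult_2 power_add power_divide)
  have R: "R = s * ((real d / exp 1) ^ d / real n ^ d)"
    by (simp add: R_def s_def power_mult_distrib power_divide)
  have "R \<le> s * (fact d / real n ^ d)"
    unfolding R using fact_ge_pow_over_exp[of d] s by (intro mult_left_mono divide_right_mono) auto
  also have "\<dots> \<le> s * (1 / real (n choose d))"
  proof -
    have "real ((n choose d) * fact d) \<le> real (n ^ d)" using binomial_fact_pow[of n d] by (simp only: of_nat_le_iff)
    then show ?thesis using s C n by (intro mult_left_mono) (auto simp: field_simps)
  qed
  finally have RT: "R \<le> T" by (simp add: T)
  have "sq_norm d > 0" using dn by (simp add: sq_norm_pos)
  moreover have "christoffel d > 0" using christoffel_ge_1[of d] dn by simp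
  moreover have "christoffel d \<le> 2 * (sq_norm d / p ^ (2 * d))" using dn small by (intro christoffel_le) auto
  ultimately have "T / 4 \<le> 1 / (2 * christoffel d)"
    using p by (simp add: T_def field_simps)
  then show "R / 4 \<le> max_all_ones n (2 * d) p"
    using RT max_all_ones_ge[OF small dn] by linarith
  have "1 / real (n choose d) \<le> exp 1 * sqrt (real d) * (real d / exp 1) ^ d * exp ((real d)\<^sup>2 / real n) / real n ^ d"
  proof -
    have "real n ^ d \<le> exp ((real d)\<^sup>2 / real n) * (real (n choose d) * fact d)"
      using falling_factorial_ge[of d n] dn by (simp add: exp_minus field_simps)
    also have "\<dots> \<le> exp ((real d)\<^sup>2 / real n) *
        (real (n choose d) * (exp 1 * sqrt (real d) * (real d / exp 1) ^ d))"
      using fact_le_sqrt_pow_over_exp[OF d] by (intro mult_left_mono) auto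
    finally show ?thesis using C n by (simp add: divide_le_eq le_divide_eq mult_ac)
  qed
  then have "s * (1 / real (n choose d)) \<le>
      s * (exp 1 * sqrt (real d) * (real d / exp 1) ^ d * exp ((real d)\<^sup>2 / real n) / real n ^ d)"
    using s by (intro mult_left_mono) auto
  then have "T \<le> exp 1 * sqrt (real d) * exp ((real d)\<^sup>2 / real n) * R"
    by (simp add: T R mult_ac)
  then show "max_all_ones n (2 * d) p \<le> exp 1 * sqrt (real d) * exp ((real d)\<^sup>2 / real n) * R"
    using max_all_ones_le[of d] dn by (simp add: T_def)
qed

text \<open>The estimate behind both regimes: the rate $R$ is sharp up to a constant from below, and up to
  $\sqrt k$ and a factor that matters only for $k$ above $\sqrt n$ from above.\<close>
lemma max_all_ones_bounds:
  fixes n k :: nat and p :: real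
  assumes p: "0 < p" "p < 1" and k: "k > 0" "even k"
    and large: "16 * real k \<le> real n * p * (1 - p)"
  defines "R \<equiv> (p * real k / (2 * exp 1 * (1 - p) * real n)) powr (real k / 2)"
  shows "R / 4 \<le> max_all_ones n k p"
    and "max_all_ones n k p \<le> exp 1 * sqrt (real k) * exp ((real k)\<^sup>2 / (4 * real n)) * R"
proof -
  obtain d where d: "k = 2 * d" "d \<ge> 1" using k by (auto elim!: evenE)
  have np: "real n > 0" using large k by (cases "n = 0") auto
  have "p * real k / (2 * exp 1 * (1 - p) * real n) > 0" using p k np by simp
  then have R: "R = (p * real d / (exp 1 * (1 - p) * real n)) ^ d"
    unfolding R_def by (simp add: d(1) powr_realpow mult.assoc)
  have large': "32 * real d \<le> real n * p * (1 - p)" using large d by simp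
  show "R / 4 \<le> max_all_ones n k p"
    unfolding R d(1) using max_all_ones_sandwich(1)[OF p d(2) large'] .
  have "max_all_ones n k p \<le> exp 1 * sqrt (real d) * exp ((real d)\<^sup>2 / real n) * R"
    unfolding R d(1) using max_all_ones_sandwich(2)[OF p d(2) large'] .
  also have "\<dots> \<le> exp 1 * sqrt (real k) * exp ((real d)\<^sup>2 / real n) * R"
    unfolding R_def by (intro mult_right_mono mult_left_mono) (auto simp: d(1))
  also have "(real d)\<^sup>2 / real n = (real k)\<^sup>2 / (4 * real n)"
    by (simp add: d(1) power2_eq_square)
  finally show "max_all_ones n k p \<le> exp 1 * sqrt (real k) * exp ((real k)\<^sup>2 / (4 * real n)) * R" .
qed

text \<open>From $\ln N \le 4m N^{1/(4m)}$ one gets $(\ln N)^m \le (4m)^m N^{1/4}$, and the threshold on $N$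
  makes $(4m)^m \le N^{1/4}$.\<close>
lemma polylog_le_sqrt:
  fixes N m :: real
  assumes "m > 0" "N > max 256 ((4 * m) powr (4 * m))"
  shows "ln N powr m \<le> N powr (1 / 2)"
proof -
  have N: "N > 256" "N \<ge> (4 * m) powr (4 * m)" using assms(2) by auto
  have "ln N \<le> N powr (1 / (4 * m)) / (1 / (4 * m))"
    using N assms(1) by (intro ln_powr_bound) auto
  then have "ln N powr m \<le> (4 * m * N powr (1 / (4 * m))) powr m"
    using N assms(1) by (intro powr_mono2) (auto simp: mult.commute)
  also have "\<dots> = (4 * m) powr m * N powr (1 / 4)"
    using assms(1) N by (simp add: powr_mult powr_powr)
  also have "(4 * m) powr m = ((4 * m) powr (4 * m)) powr (1 / 4)"
    by (simp add: powr_powr)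
  also have "\<dots> * N powr (1 / 4) \<le> N powr (1 / 4) * N powr (1 / 4)"
    using N by (intro mult_right_mono powr_mono2) auto
  also have "\<dots> = N powr (1 / 2)" by (simp flip: powr_add)
  finally show ?thesis .
qed

lemma powr_le_fraction:
  fixes N \<beta> :: real
  assumes "\<beta> < 1" "N > 16 powr (1 / (1 - \<beta>))"
  shows "16 * N powr \<beta> \<le> N"
proof -
  have N: "N > 0" using assms(2) by (rule le_less_trans[rotated]) simp
  have "16 = (16 powr (1 / (1 - \<beta>))) powr (1 - \<beta>)" using assms(1) by (simp add: powr_powr)
  also have "\<dots> \<le> N powr (1 - \<beta>)" using assms by (intro powr_mono2) auto
  finally have "16 * N powr \<beta> \<le> N powr (1 - \<beta>) * N powr \<beta>" by (rule mult_right_mono) simp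
  also have "\<dots> = N" using N by (simp flip: powr_add)
  finally show ?thesis .
qed

text \<open>Here $k^2 \le N \le n$, so the exponential correction is at most $e$.\<close>
lemma polylog_regime:
  fixes n k :: nat and m p :: real
  assumes "m > 0" "k > 0" "even k" "0 < p" "p < 1"
    and N: "N = real n * p * (1 - p) - 1" "N > max 256 ((4 * m) powr (4 * m))"
    and k: "real k \<le> ln N powr m"
    and R: "R = (p * real k / (2 * exp 1 * (1 - p) * real n)) powr (real k / 2)"
  shows "(1 / 4) / sqrt (real k) * R \<le> max_all_ones n k p"
    and "max_all_ones n k p \<le> exp 2 * sqrt (real k) * R"
proof -
  have kN: "real k \<le> N powr (1 / 2)" using k polylog_le_sqrt[OF assms(1) N(2)] by simp
  have "16 powr (1 / (1 - 1 / 2)) = (256 :: real)" by (simp add: powr_numeral)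
  then have "16 * N powr (1 / 2) \<le> N" using N(2) by (intro powr_le_fraction) auto
  then have large: "16 * real k \<le> real n * p * (1 - p)" using kN N(1) by simp
  note b = max_all_ones_bounds[OF assms(4,5,2,3) large, folded R]
  have R0: "R \<ge> 0" by (simp add: R)
  have "(1 / 4) / sqrt (real k) * R \<le> (1 / 4) / 1 * R"
    using assms(2) R0 by (intro mult_right_mono divide_left_mono) auto
  then show "(1 / 4) / sqrt (real k) * R \<le> max_all_ones n k p" using b(1) by simp
  have "p * (1 - p) \<le> 1" using assms(4,5) by (intro mult_le_one) auto
  then have "real n * (p * (1 - p)) \<le> real n * 1" by (intro mult_left_mono) auto
  then have nN: "N \<le> real n" using N(1) by (simp add: mult.assoc)
  have "(real k)\<^sup>2 \<le> (N powr (1 / 2))\<^sup>2" using kN by (intro power_mono) auto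
  also have "\<dots> = N" using N(2) by (simp add: powr_half_sqrt)
  finally have "(real k)\<^sup>2 \<le> 4 * real n" using nN by simp
  then have "(real k)\<^sup>2 / (4 * real n) \<le> 1" using nN N(2) by (simp add: divide_le_eq)
  then have "exp 1 * sqrt (real k) * exp ((real k)\<^sup>2 / (4 * real n)) * R \<le> exp 1 * sqrt (real k) * exp 1 * R"
    using R0 by (intro mult_right_mono mult_left_mono) auto
  also have "\<dots> = exp 2 * sqrt (real k) * R"
    using exp_add[of "1::real" 1] by simp
  finally show "max_all_ones n k p \<le> exp 2 * sqrt (real k) * R" using b(2) by simp
qed

text \<open>The lower bound holds with the constant $1/4$ in place of $e^{-k/U}$, hence for every positive
  $U$.\<close>
lemma power_regime:
  fixes n k :: nat and \<beta> p :: real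
  assumes "\<beta> < 1" "k > 0" "even k" "0 < p" "p < 1"
    and N: "N = real n * p * (1 - p) - 1" "N > 16 powr (1 / (1 - \<beta>))"
    and k: "real k \<le> N powr \<beta>"
    and R: "R = (p * real k / (2 * exp 1 * (1 - p) * real n)) powr (real k / 2)"
    and U: "U > 0"
  shows "1 / exp 2 * exp (- (real k / U)) * R \<le> max_all_ones n k p"
    and "max_all_ones n k p \<le> exp 2 * sqrt (real k) * exp ((real k)\<^sup>2 / (2 * real n)) * R"
proof -
  have large: "16 * real k \<le> real n * p * (1 - p)"
    using powr_le_fraction[OF assms(1) N(2)] k N(1) by simp
  then have n: "real n > 0" using assms(2) by (cases "n = 0") auto
  note b = max_all_ones_bounds[OF assms(4,5,2,3) large, folded R]
  have R0: "R \<ge> 0" by (simp add: R)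
  have e: "exp (1::real) \<ge> 2" using exp_ge_add_one_self[of 1] by simp
  have "exp (2::real) = exp 1 * exp 1" by (simp flip: exp_add)
  also have "\<dots> \<ge> 2 * 2" using e by (intro mult_mono) auto
  finally have e2: "exp (2::real) \<ge> 4" by simp
  have "1 / exp 2 * exp (- (real k / U)) \<le> 1 / 4 * 1"
    using e2 U by (intro mult_mono divide_left_mono) auto
  then have "1 / exp 2 * exp (- (real k / U)) * R \<le> 1 / 4 * 1 * R" using R0 by (rule mult_right_mono)
  then show "1 / exp 2 * exp (- (real k / U)) * R \<le> max_all_ones n k p" using b(1) by linarith
  have "exp 1 * sqrt (real k) * exp ((real k)\<^sup>2 / (4 * real n)) * R \<le>
      exp 2 * sqrt (real k) * exp ((real k)\<^sup>2 / (2 * real n)) * R"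
    using R0 n by (intro mult_right_mono mult_mono) (auto intro!: divide_left_mono)
  then show "max_all_ones n k p \<le> exp 2 * sqrt (real k) * exp ((real k)\<^sup>2 / (2 * real n)) * R"
    using b(2) by simp
qed

theorem corollary1p3:
  shows "\<exists>C c :: real. C > 0 \<and> c > 0 \<and>
    (\<forall>m::real. m > 0 \<longrightarrow>
      (\<exists>N0::real. \<forall>(n::nat) (k::nat) (p::real).
        n > 0 \<longrightarrow> k > 0 \<longrightarrow> even k \<longrightarrow> 0 < p \<longrightarrow> p < 1 \<longrightarrow>
        (let N = real n * p * (1 - p) - 1;
             R = (p * real k / (2 * exp 1 * (1 - p) * real n)) powr (real k / 2)
         in N > N0 \<longrightarrow> real k \<le> ln N powr m \<longrightarrow>
            c / sqrt (real k) * R \<le> max_all_ones n k p \<and>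
            max_all_ones n k p \<le> C * sqrt (real k) * R))) \<and>
    (\<forall>\<beta>::real. 0 < \<beta> \<longrightarrow> \<beta> < 1 \<longrightarrow>
      (\<exists>c\<beta> N0 :: real. c\<beta> > 0 \<and> (\<forall>(n::nat) (k::nat) (p::real).
        n > 0 \<longrightarrow> k > 0 \<longrightarrow> even k \<longrightarrow> 0 < p \<longrightarrow> p < 1 \<longrightarrow>
        (let N = real n * p * (1 - p) - 1;
             R = (p * real k / (2 * exp 1 * (1 - p) * real n)) powr (real k / 2);
             U = exp (c\<beta> * sqrt (ln (real k) * ln (ln (2 * real k))))
         in N > N0 \<longrightarrow> real k \<le> N powr \<beta> \<longrightarrow>
            1 / C * exp (- (real k / U)) * R \<le> max_all_ones n k p \<and>
            max_all_ones n k p \<le>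
              C * sqrt (real k) * exp ((real k)\<^sup>2 / (2 * real n)) * R))))"
proof (rule exI[of _ "exp 2"], rule exI[of _ "1 / 4"], intro conjI allI impI)
  fix m :: real assume m: "m > 0"
  show "\<exists>N0::real. \<forall>(n::nat) (k::nat) (p::real).
        n > 0 \<longrightarrow> k > 0 \<longrightarrow> even k \<longrightarrow> 0 < p \<longrightarrow> p < 1 \<longrightarrow>
        (let N = real n * p * (1 - p) - 1;
             R = (p * real k / (2 * exp 1 * (1 - p) * real n)) powr (real k / 2)
         in N > N0 \<longrightarrow> real k \<le> ln N powr m \<longrightarrow>
            1 / 4 / sqrt (real k) * R \<le> max_all_ones n k p \<and>
            max_all_ones n k p \<le> exp 2 * sqrt (real k) * R)"
    unfolding Let_def
    by (intro exI[of _ "max 256 ((4 * m) powr (4 * m))"] allI impI conjI)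
       (rule polylog_regime[OF m _ _ _ _ refl _ _ refl]; assumption)+
next
  fix \<beta> :: real assume \<beta>: "0 < \<beta>" "\<beta> < 1"
  show "\<exists>c\<beta> N0 :: real. c\<beta> > 0 \<and> (\<forall>(n::nat) (k::nat) (p::real).
        n > 0 \<longrightarrow> k > 0 \<longrightarrow> even k \<longrightarrow> 0 < p \<longrightarrow> p < 1 \<longrightarrow>
        (let N = real n * p * (1 - p) - 1;
             R = (p * real k / (2 * exp 1 * (1 - p) * real n)) powr (real k / 2);
             U = exp (c\<beta> * sqrt (ln (real k) * ln (ln (2 * real k))))
         in N > N0 \<longrightarrow> real k \<le> N powr \<beta> \<longrightarrow>
            1 / exp 2 * exp (- (real k / U)) * R \<le> max_all_ones n k p \<and>
            max_all_ones n k p \<le>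
              exp 2 * sqrt (real k) * exp ((real k)\<^sup>2 / (2 * real n)) * R))"
    unfolding Let_def
    by (intro exI[of _ "1::real"] exI[of _ "16 powr (1 / (1 - \<beta>))"] allI impI conjI zero_less_one)
       (rule power_regime[OF \<beta>(2) _ _ _ _ refl _ _ refl exp_gt_zero]; assumption)+
qed simp_all

end
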